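(* Let $\xi_1,\xi_2,\ldots$ be independent identically distributed real random variables on a probability space $(\Omega,\mathcal F,\mathbb P)$ with zero mean and finite variance $\sigma^2$, where $\sigma>0$. Put $S_0=0$, $S_n=\xi_1+\ldots+\xi_n$, and for $n\ge 1$ let $X^n=(X^n_t)_{0\le t\le 1}$ be the random element of $C[0,1]$ defined by linear interpolation between its values $X^n_{i/n}(\omega)=\frac{S_i(\omega)}{\sigma\sqrt n}$ at the points $t=i/n$, $i=0,1,\ldots,n$. Then $X^n$ converges in distribution in $C[0,1]$, as $n\to\infty$, to the standard Wiener process $W=(W_t)_{0\le t\le 1}$.
   Context: $C[0,1]$ is the space of continuous functions $x:[0,1]\to\mathbb R$ with the uniform metric $\rho(x,y)=\sup_{0\le t\le1}|x(t)-y(t)|$ and its Borel $\sigma$-algebra. Convergence in distribution $X^n\Rightarrow X$ of random elements of a metric space means $\mathbb E f(X^n)\to\mathbb E f(X)$ for every bounded continuous real function $f$ on the space. The standard Wiener process $W$ is the random element of $C[0,1]$ with $W_0=0$ whose increments over disjoint intervals are independent, with $W_t-W_s$ normally distributed with mean $0$ and variance $t-s$ for $s\le t$. *)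

theory Defs
  imports "HOL-Probability.Probability"
begin

section \<open>The space C[0,1]\<close>

typedef unit_interval = "{0..1::real}"
  by auto

instantiation unit_interval :: metric_space
begin

definition dist_unit_interval :: "unit_interval \<Rightarrow> unit_interval \<Rightarrow> real"
  where "dist_unit_interval s t = \<bar>Rep_unit_interval s - Rep_unit_interval t\<bar>"

definition uniformity_unit_interval :: "(unit_interval \<times> unit_interval) filter"
  where "uniformity_unit_interval = (INF e\<in>{0 <..}. principal {(s, t). dist s t < e})"

definition open_unit_interval :: "unit_interval set \<Rightarrow> bool"
  where "open_unit_interval U \<longleftrightarrow> (\<forall>s\<in>U. \<forall>\<^sub>F (s', t) in uniformity. s' = s \<longrightarrow> t \<in> U)"

instance
proof
  fix s t u :: unit_interval
  show "dist s t = 0 \<longleftrightarrow> s = t"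
    by (auto simp: dist_unit_interval_def Rep_unit_interval_inject)
  show "dist s t \<le> dist s u + dist t u"
    by (auto simp: dist_unit_interval_def)
qed (rule open_unit_interval_def uniformity_unit_interval_def)+

end

lemma continuous_on_Abs_unit_interval: "continuous_on {0..1} Abs_unit_interval"
  by (auto simp: continuous_on_iff dist_unit_interval_def Abs_unit_interval_inverse dist_real_def)

lemma continuous_on_Rep_unit_interval: "continuous_on A Rep_unit_interval"
  by (auto simp: continuous_on_iff dist_unit_interval_def dist_real_def)

lemma compact_UNIV_unit_interval: "compact (UNIV :: unit_interval set)"
proof -
  have "(UNIV :: unit_interval set) = Abs_unit_interval ` {0..1}"
    by (metis Abs_unit_interval_cases UNIV_eq_I imageI)
  then show ?thesis
    using compact_continuous_image[OF continuous_on_Abs_unit_interval] by simp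
qed

text \<open>
  Since the interval is compact, the library type of bounded continuous functions on it
  contains all continuous functions. Its metric is the supremum metric, and \<^const>\<open>borel\<close>
  at this type is the Borel sigma-algebra of that metric.
\<close>

type_synonym C01 = "unit_interval \<Rightarrow>\<^sub>C real"

lemma continuous_imp_bcontfun:
  fixes f :: "unit_interval \<Rightarrow> real"
  assumes "continuous_on UNIV f"
  shows "f \<in> bcontfun"
  using compact_continuous_image[OF assms compact_UNIV_unit_interval] assms
  by (auto simp: bcontfun_def compact_imp_bounded)

text \<open>Evaluation at a real time; only meaningful for times in \<open>[0,1]\<close>.\<close>

definition value_at :: "C01 \<Rightarrow> real \<Rightarrow> real"
  where "value_at x t = apply_bcontfun x (Abs_unit_interval t)"

lemma dist_C01: "dist x y = (SUP t\<in>{0..1}. \<bar>value_at x t - value_at y t\<bar>)"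
proof -
  have U: "(UNIV :: unit_interval set) = Abs_unit_interval ` {0..1}"
    by (metis Abs_unit_interval_cases UNIV_eq_I imageI)
  show ?thesis
    unfolding dist_bcontfun.rep_eq value_at_def dist_real_def by (subst U) (simp add: image_image)
qed

section \<open>Linear interpolation\<close>

text \<open>
  The path \<open>x\<close> takes the value \<open>v i\<close> at \<open>i/n\<close> (take \<open>s = 0\<close> or \<open>s = 1\<close>) for
  \<open>i = 0, \<dots>, n\<close> and is affine between consecutive such points.
\<close>

definition linear_interpolation :: "nat \<Rightarrow> (nat \<Rightarrow> real) \<Rightarrow> C01 \<Rightarrow> bool" where
  "linear_interpolation n v x \<longleftrightarrow>
     (\<forall>i<n. \<forall>s\<in>{0..1}.
        value_at x ((real i + s) / real n) = (1 - s) * v i + s * v (Suc i))"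

lemma linear_interpolation_exists:
  assumes "n \<ge> 1"
  shows "\<exists>x. linear_interpolation n v x"
proof -
  define g where
    "g t = v 0 + (\<Sum>j<n. (v (Suc j) - v j) * max 0 (min 1 (real n * t - real j)))" for t :: real
  have "(\<lambda>t. g (Rep_unit_interval t)) \<in> bcontfun"
    unfolding g_def
    by (intro continuous_imp_bcontfun continuous_intros continuous_on_Rep_unit_interval)
  then obtain x :: C01 where x: "(\<lambda>t. g (Rep_unit_interval t)) = apply_bcontfun x"
    by (rule bcontfunE)
  have "value_at x ((real i + s) / real n) = (1 - s) * v i + s * v (Suc i)"
    if i: "i < n" and s: "s \<in> {0..1}" for i s
  proof -
    have i1: "real i + 1 \<le> real n" using i by linarith
    have "(real i + s) / real n \<in> {0..1}"
      using i1 s assms by (auto simp: field_simps)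
    then have "value_at x ((real i + s) / real n) = g ((real i + s) / real n)"
      by (simp add: value_at_def x[symmetric] Abs_unit_interval_inverse)
    also have "\<dots> = v 0 + (\<Sum>j<n. (v (Suc j) - v j) *
        (if j < i then 1 else if j = i then s else 0))"
    proof -
      have "max 0 (min 1 (real i + s - real j)) =
          (if j < i then 1 else if j = i then s else 0)" for j
      proof (cases j i rule: linorder_cases)
        case less
        then have "real j + 1 \<le> real i" by linarith
        then show ?thesis using less s by auto
      next
        case greater
        then have "real i + 1 \<le> real j" by linarith
        then show ?thesis using greater s by auto
      qed (use s in auto)
      then show ?thesis using assms by (simp add: g_def)
    qed
    also have "(\<Sum>j<n. (v (Suc j) - v j) * (if j < i then 1 else if j = i then s else 0)) =
        (\<Sum>j<Suc i. (v (Suc j) - v j) * (if j < i then 1 else if j = i then s else 0))"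
      by (rule sum.mono_neutral_right) (use i in auto)
    also have "\<dots> = (v i - v 0) + (v (Suc i) - v i) * s"
      by (simp add: sum_lessThan_telescope)
    finally show ?thesis by (simp add: algebra_simps)
  qed
  then show ?thesis unfolding linear_interpolation_def by blast
qed

lemma linear_interpolation_unique:
  assumes "n \<ge> 1" "linear_interpolation n v x" "linear_interpolation n v y"
  shows "x = y"
proof (rule bcontfun_eqI)
  fix u
  obtain t where u: "u = Abs_unit_interval t" and t: "t \<in> {0..1}"
    by (rule Abs_unit_interval_cases)
  have "\<exists>i<n. \<exists>s\<in>{0..1}. t = (real i + s) / real n"
  proof (cases "t = 1")
    case True
    then show ?thesis using assms(1)
      by (intro exI[of _ "n - 1"] conjI bexI[of _ 1]) (auto simp: of_nat_diff)
  next
    case False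
    let ?i = "nat \<lfloor>real n * t\<rfloor>"
    have "real n * t < real n * 1"
      by (rule mult_strict_left_mono) (use False t assms(1) in auto)
    then have n: "real n * t < real n" by simp
    have p: "0 \<le> real n * t" using t by simp
    have r: "real ?i = of_int \<lfloor>real n * t\<rfloor>" using p by simp
    show ?thesis
    proof (intro exI[of _ ?i] conjI bexI[of _ "real n * t - real ?i"])
      show "?i < n" using n p by linarith
      show "t = (real ?i + (real n * t - real ?i)) / real n" using assms(1) by simp
      show "real n * t - real ?i \<in> {0..1}"
        unfolding r by (simp, linarith)
    qed
  qed
  then show "apply_bcontfun x u = apply_bcontfun y u"
    using assms(2,3) unfolding linear_interpolation_def value_at_def u by metis
qed

section \<open>Convergence in distribution\<close>

definition converges_in_distribution ::
  "'a measure \<Rightarrow> (nat \<Rightarrow> 'a \<Rightarrow> 's::metric_space) \<Rightarrow> 'b measure \<Rightarrow> ('b \<Rightarrow> 's) \<Rightarrow> bool"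
where
  "converges_in_distribution M X N Y \<longleftrightarrow>
     (\<forall>n. X n \<in> borel_measurable M) \<and> Y \<in> borel_measurable N \<and>
     (\<forall>f :: 's \<Rightarrow> real. continuous_on UNIV f \<and> bounded (range f) \<longrightarrow>
        (\<lambda>n. \<integral>\<omega>. f (X n \<omega>) \<partial>M) \<longlonglongrightarrow> (\<integral>\<omega>. f (Y \<omega>) \<partial>N))"

section \<open>The standard Wiener process\<close>

text \<open>
  Increments over a degenerate interval vanish, so that the normality condition is only
  stated for \<open>s < t\<close>, where \<^const>\<open>normal_density\<close> (parametrised by the standard
  deviation) is a density. Intervals are half-open, so that adjacent ones count as disjoint.
\<close>

definition standard_wiener :: "'b measure \<Rightarrow> ('b \<Rightarrow> C01) \<Rightarrow> bool" where
  "standard_wiener N W \<longleftrightarrow>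
     prob_space N \<and>
     W \<in> borel_measurable N \<and>
     (AE \<omega> in N. value_at (W \<omega>) 0 = 0) \<and>
     (\<forall>(I :: nat set) a b.
        finite I \<and> (\<forall>i\<in>I. 0 \<le> a i \<and> a i \<le> b i \<and> b i \<le> 1) \<and>
        disjoint_family_on (\<lambda>i. {a i<..b i}) I \<longrightarrow>
        prob_space.indep_vars N (\<lambda>_. borel)
          (\<lambda>i \<omega>. value_at (W \<omega>) (b i) - value_at (W \<omega>) (a i)) I) \<and>
     (\<forall>s t. 0 \<le> s \<and> s < t \<and> t \<le> 1 \<longrightarrow>
        distributed N lborel (\<lambda>\<omega>. value_at (W \<omega>) t - value_at (W \<omega>) s)
          (normal_density 0 (sqrt (t - s))))"

end

theory Submission
  imports Defs
begin

text \<open>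
  This is Donsker's invariance principle. The rescaled walk and the Wiener process are both compared
  with broken lines that have a fixed number of pieces, where the question is finite-dimensional.

  It suffices to test against bounded Lipschitz functions \<open>f\<close>, because a bounded continuous
  function is a decreasing pointwise limit of such functions
  (\<open>converges_in_distribution_lipschitzI\<close>). Fix a number \<open>k\<close> of blocks and put \<open>L = n div k\<close>. The
  coarse path joins the values of the rescaled walk at the times \<open>0, L, \<dots>, k L\<close> by straight lines
  over the grid \<open>0, 1/k, \<dots>, 1\<close>, ignoring the mismatch between \<open>k L\<close> and \<open>n\<close>.

  As \<open>n \<rightarrow> \<infinity>\<close> with \<open>k\<close> fixed, the coarse path is a continuous function of \<open>k\<close> independent block
  increments with a common law, and each of them is asymptotically normal by the central limit theorem.
  Coupling the block laws with their limit through Skorohod's theorem and taking the product of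
  \<open>k\<close> copies of the coupling yields the joint limit (\<open>coarse_path_converges\<close>), which is the law of
  the Wiener path interpolated along the grid of mesh \<open>1/k\<close> (\<open>wiener_polygon_expectation\<close>).
  As \<open>k \<rightarrow> \<infinity>\<close> these interpolations converge to the Wiener path, which is uniformly continuous
  (\<open>wiener_polygon_converges\<close>).

  It remains to see that the full path is uniformly close to the coarse one, with high probability as
  first \<open>n\<close> and then \<open>k\<close> grows. Their distance is at most three times the largest fluctuation of
  the walk inside one of \<open>k + 1\<close> consecutive blocks (\<open>coarse_interpolation_dist\<close>). Second
  moments bound the probability of a large fluctuation in one block by a multiple of \<open>1/k\<close>
  only, which does not survive a union over all blocks. Ottaviani's inequality reduces the maximum
  over a block to the endpoint of the block, and there the central limit theorem provides the
  Gaussian fourth moment and thus a bound of order \<open>1/k\<^sup>2\<close> (\<open>block_fluctuation\<close>).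
\<close>

section \<open>Broken lines in C[0,1]\<close>

text \<open>
  Path \<open>j\<close> rises linearly from \<open>0\<close> to \<open>1\<close> over the
  \<open>j\<close>-th cell of the grid of mesh \<open>1/n\<close> and is constant elsewhere.
\<close>

definition ramp :: "nat \<Rightarrow> nat \<Rightarrow> C01" where
  "ramp n j = Bcontfun (\<lambda>t. max 0 (min 1 (real n * Rep_unit_interval t - real j)))"

text \<open>
  The broken line through \<open>0\<close> with increment \<open>y j\<close> over the
  \<open>j\<close>-th cell of the grid of mesh \<open>1/n\<close>. Writing it as a linear
  combination of fixed paths makes its continuity and measurability in the increments evident.
\<close>

definition polygon :: "nat \<Rightarrow> (nat \<Rightarrow> real) \<Rightarrow> C01" where
  "polygon n y = (\<Sum>j<n. y j *\<^sub>R ramp n j)"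

lemma value_at_ramp:
  assumes "t \<in> {0..1}"
  shows "value_at (ramp n j) t = max 0 (min 1 (real n * t - real j))"
proof -
  have "(\<lambda>t. max 0 (min 1 (real n * Rep_unit_interval t - real j))) \<in> bcontfun"
    by (intro continuous_imp_bcontfun continuous_intros continuous_on_Rep_unit_interval)
  then show ?thesis
    using assms by (simp add: value_at_def ramp_def Bcontfun_inverse Abs_unit_interval_inverse)
qed

lemma value_at_polygon:
  assumes "t \<in> {0..1}"
  shows "value_at (polygon n y) t = (\<Sum>j<n. y j * max 0 (min 1 (real n * t - real j)))"
proof -
  have "apply_bcontfun (\<Sum>j\<in>A. y j *\<^sub>R ramp n j) u = (\<Sum>j\<in>A. y j * apply_bcontfun (ramp n j) u)"
    for A u by (induction A rule: infinite_finite_induct) auto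
  then show ?thesis
    using value_at_ramp[OF assms] by (simp add: polygon_def value_at_def)
qed

lemma polygon_linear_interpolation:
  assumes n: "n \<ge> 1" and v0: "v 0 = 0"
  shows "linear_interpolation n v (polygon n (\<lambda>j. v (Suc j) - v j))"
  unfolding linear_interpolation_def
proof (intro allI impI ballI)
  fix i s assume i: "i < n" and s: "s \<in> {0..1::real}"
  have i1: "real i + 1 \<le> real n" using i by linarith
  have ramp_value: "max 0 (min 1 (real i + s - real j)) =
      (if j < i then 1 else if j = i then s else 0)" for j
  proof (cases j i rule: linorder_cases)
    case less
    then have "real j + 1 \<le> real i" by linarith
    then show ?thesis using less s by auto
  next
    case greater
    then have "real i + 1 \<le> real j" by linarith
    then show ?thesis using greater s by auto
  qed (use s in auto)
  have "(real i + s) / real n \<in> {0..1}"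
    using i1 s n by (auto simp: field_simps)
  then have "value_at (polygon n (\<lambda>j. v (Suc j) - v j)) ((real i + s) / real n) =
      (\<Sum>j<n. (v (Suc j) - v j) * (if j < i then 1 else if j = i then s else 0))"
    using n by (subst value_at_polygon) (simp_all add: ramp_value)
  also have "\<dots> = (\<Sum>j<Suc i. (v (Suc j) - v j) * (if j < i then 1 else if j = i then s else 0))"
    by (rule sum.mono_neutral_right) (use i in auto)
  also have "\<dots> = v i + (v (Suc i) - v i) * s"
    using v0 by (simp add: sum_lessThan_telescope)
  finally show "value_at (polygon n (\<lambda>j. v (Suc j) - v j)) ((real i + s) / real n) =
      (1 - s) * v i + s * v (Suc i)"
    by (simp add: algebra_simps)
qed

lemma C01_dist_le:
  assumes "\<And>t. t \<in> {0..1} \<Longrightarrow> \<bar>value_at x t - value_at y t\<bar> \<le> b"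
  shows "dist x y \<le> b"
  unfolding dist_C01 by (rule cSUP_least) (use assms in auto)

text \<open>
  The last clause says that \<open>s = 1\<close> occurs only at the right end of the interval, so
  that otherwise the point lies strictly before the next grid point.
\<close>

lemma grid_cell:
  assumes t: "t \<in> {0..1::real}" and n: "n \<ge> 1"
  obtains i s where "i < n" "s \<in> {0..1}" "t = (real i + s) / real n" "s < 1 \<or> Suc i = n"
proof (cases "t = 1")
  case True
  show ?thesis
    by (rule that[of "n - 1" 1]) (use True n in \<open>auto simp: of_nat_diff\<close>)
next
  case False
  define i where "i = nat \<lfloor>real n * t\<rfloor>"
  have "real n * t < real n * 1"
    by (rule mult_strict_left_mono) (use False t n in auto)
  moreover have "0 \<le> real n * t" using t by simp
  ultimately have i: "i < n" "real i \<le> real n * t" "real n * t - real i < 1"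
    unfolding i_def by linarith+
  show ?thesis
    by (rule that[of i "real n * t - real i"]) (use i n in auto)
qed

lemma convex_combination_dist:
  fixes a b c d s :: real
  assumes "\<bar>a - c\<bar> \<le> d" "\<bar>b - c\<bar> \<le> d" "s \<in> {0..1}"
  shows "\<bar>(1 - s) * a + s * b - c\<bar> \<le> d"
proof -
  have "(1 - s) * a + s * b - c = (1 - s) * (a - c) + s * (b - c)"
    by (simp add: algebra_simps)
  also have "\<bar>\<dots>\<bar> \<le> \<bar>(1 - s) * (a - c)\<bar> + \<bar>s * (b - c)\<bar>"
    by (rule abs_triangle_ineq)
  also have "\<dots> = (1 - s) * \<bar>a - c\<bar> + s * \<bar>b - c\<bar>"
    using assms(3) by (simp add: abs_mult)
  also have "\<dots> \<le> (1 - s) * d + s * d"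
    using assms by (intro add_mono mult_left_mono) auto
  finally show ?thesis by (simp add: algebra_simps)
qed

text \<open>
  A path is uniformly continuous, so on each cell of a fine grid it stays close to its values at
  both endpoints, and hence to their convex combinations.
\<close>

lemma interpolations_converge:
  fixes x :: C01 and z :: "nat \<Rightarrow> C01"
  assumes z: "\<And>k. linear_interpolation (Suc k) (\<lambda>i. value_at x (real i / real (Suc k))) (z k)"
  shows "z \<longlonglongrightarrow> x"
proof (rule metric_LIMSEQ_I)
  fix e :: real assume e: "0 < e"
  have "continuous_on {0..1} (value_at x)"
    unfolding value_at_def
    by (rule continuous_on_compose2[OF continuous_on_apply_bcontfun continuous_on_Abs_unit_interval])
       auto
  then have "uniformly_continuous_on {0..1} (value_at x)"
    by (rule compact_uniformly_continuous) auto
  then obtain d where d: "d > 0" and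
    close: "\<And>s t. \<lbrakk>s \<in> {0..1}; t \<in> {0..1}; \<bar>t - s\<bar> < d\<rbrakk> \<Longrightarrow> \<bar>value_at x t - value_at x s\<bar> < e / 2"
    unfolding uniformly_continuous_on_def dist_real_def by (metis half_gt_zero[OF e])
  obtain k0 where k0: "1 / real (Suc k0) < d"
    using d nat_approx_posE by blast
  have "dist (z k) x < e" if "k \<ge> k0" for k
  proof -
    have small: "1 / real (Suc k) < d"
      using k0 that by (smt (verit) frac_le of_nat_0_less_iff of_nat_mono zero_less_Suc Suc_le_mono)
    have "dist (z k) x \<le> e / 2"
    proof (rule C01_dist_le)
      fix t :: real assume t: "t \<in> {0..1}"
      obtain i s where i: "i < Suc k" and s: "s \<in> {0..1}" and ts: "t = (real i + s) / real (Suc k)"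
        by (rule grid_cell[OF t, of "Suc k"]) auto
      have ends: "real j / real (Suc k) \<in> {0..1}" if "j = i \<or> j = Suc i" for j
        using that i by (auto simp: field_simps)
      have "real i / real (Suc k) \<le> t" "t \<le> real (Suc i) / real (Suc k)"
        unfolding ts using s by (auto intro!: divide_right_mono)
      moreover have "real (Suc i) / real (Suc k) = real i / real (Suc k) + 1 / real (Suc k)"
        by (simp add: add_divide_distrib)
      ultimately have *: "\<bar>real j / real (Suc k) - t\<bar> < d" if "j = i \<or> j = Suc i" for j
        using that small by auto
      have near: "\<bar>value_at x (real j / real (Suc k)) - value_at x t\<bar> \<le> e / 2" if "j = i \<or> j = Suc i" for j
        using close[OF t ends[OF that] *[OF that]] by simp
      have "\<bar>(1 - s) * value_at x (real i / real (Suc k)) + s * value_at x (real (Suc i) / real (Suc k))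
          - value_at x t\<bar> \<le> e / 2"
        by (rule convex_combination_dist[OF near near s]) simp_all
      then show "\<bar>value_at (z k) t - value_at x t\<bar> \<le> e / 2"
        using z[of k] i s unfolding linear_interpolation_def ts[symmetric] by (metis ts)
    qed
    then show ?thesis using e by simp
  qed
  then show "\<exists>k0. \<forall>k\<ge>k0. dist (z k) x < e" by blast
qed

text \<open>
  A time in the \<open>j\<close>-th cell of the coarse grid corresponds, on the fine time scale, to
  a position between \<open>j L\<close> and \<open>(j + 1) (L + 1)\<close>. When
  \<open>L \<ge> k\<close>, this is at most \<open>(j + 2) L\<close>, although up to
  \<open>k\<close> indices are lost by rounding. The fine path is therefore within two block
  fluctuations of \<open>v (j L)\<close>, and the coarse path within one. Block \<open>k\<close>
  enters because the position may run past \<open>k L\<close>.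
\<close>

lemma coarse_interpolation_dist:
  fixes x z :: C01 and v :: "nat \<Rightarrow> real"
  assumes k: "k \<ge> 1" and L: "L = n div k" "L \<ge> k"
    and x: "linear_interpolation n v x"
    and z: "linear_interpolation k (\<lambda>j. v (j * L)) z"
    and fluct: "\<And>i j. \<lbrakk>j \<le> k; i \<le> L\<rbrakk> \<Longrightarrow> \<bar>v (j * L + i) - v (j * L)\<bar> \<le> d"
  shows "dist x z \<le> 3 * d"
proof (rule C01_dist_le)
  fix t :: real assume t: "t \<in> {0..1}"
  have kL: "k * L \<le> n" "n < k * (L + 1)"
    using k L(1) by (auto simp: dividend_less_times_div)
  have n: "n \<ge> 1" using L k kL by (metis One_nat_def Suc_leI le_trans mult_le_mono nat_mult_1_right)
  obtain i s where i: "i < n" and s: "s \<in> {0..1}" and ts: "t = (real i + s) / real n"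
    and last_i: "s < 1 \<or> Suc i = n"
    by (rule grid_cell[OF t n])
  obtain j r where j: "j < k" and r: "r \<in> {0..1}" and tr: "t = (real j + r) / real k"
    and last_j: "r < 1 \<or> Suc j = k"
    by (rule grid_cell[OF t k])
  have cross: "(real i + s) * real k = (real j + r) * real n"
    using ts tr n k by (simp add: field_simps)
  \<comment> \<open>The last fine cell needs a separate argument, since there \<open>s = 1\<close> is possible.\<close>
  have lower: "j * L \<le> i"
  proof (cases "Suc i = n")
    case True
    have "j * L + L \<le> k * L" using j by (metis Suc_leI add.commute mult_Suc mult_le_mono1)
    then show ?thesis using True kL(1) L(2) k by linarith
  next
    case False
    then have "s < 1" using last_i by simp
    have "real j * real (k * L) \<le> real j * real n"
      using kL by (intro mult_left_mono) linarith+
    also have "\<dots> \<le> (real i + s) * real k"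
      unfolding cross using r by (intro mult_right_mono) auto
    also have "\<dots> < (real i + 1) * real k"
      using \<open>s < 1\<close> k by (intro mult_strict_right_mono) auto
    finally have "real (j * L) * real k < real (i + 1) * real k" by (simp add: algebra_simps)
    then have "real (j * L) < real (i + 1)" using k by simp
    then show ?thesis by linarith
  qed
  have upper: "Suc i \<le> j * L + 2 * L"
  proof -
    have "real i * real k \<le> (real i + s) * real k"
      using s by (intro mult_right_mono) auto
    also have "\<dots> \<le> (real j + 1) * real n"
      unfolding cross using r by (intro mult_right_mono) auto
    also have "\<dots> < (real j + 1) * real (k * (L + 1))"
      using kL by (intro mult_strict_left_mono) linarith+
    finally have "real i * real k < real ((j + 1) * (L + 1)) * real k" by (simp add: algebra_simps)
    then have "real i < real ((j + 1) * (L + 1))" using k by simp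
    then have "Suc i \<le> (j + 1) * (L + 1)" by linarith
    also have "\<dots> \<le> j * L + 2 * L" using j L(2) by simp
    finally show ?thesis .
  qed
  have near: "\<bar>v m - v (j * L)\<bar> \<le> 2 * d" if m: "j * L \<le> m" "m \<le> j * L + 2 * L" for m
  proof (cases "m \<le> j * L + L")
    case True
    have "\<bar>v (j * L + (m - j * L)) - v (j * L)\<bar> \<le> d"
      using True j by (intro fluct) auto
    moreover have "0 \<le> d" using fluct[of 0 0] by simp
    ultimately show ?thesis using m by simp
  next
    case False
    then have eq: "m = Suc j * L + (m - Suc j * L)" by simp
    have "\<bar>v m - v (Suc j * L)\<bar> \<le> d"
      by (subst eq, rule fluct) (use j m in auto)
    moreover have "\<bar>v (j * L + L) - v (j * L)\<bar> \<le> d" using j by (intro fluct) auto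
    ultimately show ?thesis by (simp add: add.commute)
  qed
  have "value_at x t = (1 - s) * v i + s * v (Suc i)"
    using x i s unfolding ts linear_interpolation_def by blast
  then have "\<bar>value_at x t - v (j * L)\<bar> \<le> 2 * d"
    using lower upper s by (auto intro!: convex_combination_dist near)
  moreover have "value_at z t = (1 - r) * v (j * L) + r * v (Suc j * L)"
    using z j r unfolding tr linear_interpolation_def by blast
  then have "\<bar>value_at z t - v (j * L)\<bar> \<le> d"
    using fluct[of j 0] fluct[of j L] j convex_combination_dist[OF _ _ r, of "v (j * L)" "v (j * L)" d "v (Suc j * L)"]
    by (simp add: add.commute)
  ultimately show "\<bar>value_at x t - value_at z t\<bar> \<le> 3 * d" by linarith
qed

lemma polygon_cong: "(\<And>j. j < k \<Longrightarrow> y j = y' j) \<Longrightarrow> polygon k y = polygon k y'"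
  by (simp add: polygon_def)

lemma tendsto_polygon:
  assumes "\<And>j. j < k \<Longrightarrow> ((\<lambda>n. y n j) \<longlongrightarrow> y0 j) F"
  shows "((\<lambda>n. polygon k (y n)) \<longlongrightarrow> polygon k y0) F"
  unfolding polygon_def using assms by (intro tendsto_intros) auto

text \<open>
  The map from increments to paths is continuous on the product space of real sequences. Since that
  space is second countable, measurability into it can be checked coordinatewise.
\<close>

lemma borel_measurable_polygon:
  assumes Y: "\<And>j. j < k \<Longrightarrow> Y j \<in> borel_measurable M"
  shows "(\<lambda>\<omega>. polygon k (\<lambda>j. Y j \<omega>)) \<in> borel_measurable M"
proof -
  have "continuous_on UNIV (polygon k)"
    unfolding polygon_def
    by (intro continuous_on_sum continuous_on_scaleR continuous_on_product_coordinates continuous_on_const)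
  then have poly: "polygon k \<in> borel_measurable borel"
    by (rule borel_measurable_continuous_onI)
  have "(\<lambda>\<omega> j. if j < k then Y j \<omega> else 0) \<in> borel_measurable M"
  proof (rule measurable_coordinatewise_then_product)
    show "(\<lambda>\<omega>. if j < k then Y j \<omega> else 0) \<in> borel_measurable M" for j
      by (cases "j < k") (use Y in auto)
  qed
  from measurable_compose[OF this poly]
  have "(\<lambda>\<omega>. polygon k (\<lambda>j. if j < k then Y j \<omega> else 0)) \<in> borel_measurable M" .
  also have "(\<lambda>\<omega>. polygon k (\<lambda>j. if j < k then Y j \<omega> else 0)) = (\<lambda>\<omega>. polygon k (\<lambda>j. Y j \<omega>))"
    by (intro ext polygon_cong) simp
  finally show ?thesis .
qed

section \<open>Criteria for convergence in distribution\<close>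

lemma lipschitz_imp_continuous:
  fixes f :: "'a::metric_space \<Rightarrow> real"
  assumes "0 \<le> K" "\<And>x y. \<bar>f x - f y\<bar> \<le> K * dist x y"
  shows "continuous_on UNIV f"
proof -
  have "K-lipschitz_on UNIV f" using assms by (auto simp: lipschitz_on_def dist_real_def)
  then show ?thesis by (rule lipschitz_on_continuous_on)
qed

lemma (in prob_space) indep_vars_integral_PiM:
  fixes X :: "'i \<Rightarrow> 'a \<Rightarrow> real" and h :: "('i \<Rightarrow> real) \<Rightarrow> real"
  assumes "I \<noteq> {}" and X: "indep_vars (\<lambda>_. borel) X I"
    and law: "\<And>i. i \<in> I \<Longrightarrow> distr M borel (X i) = \<mu>"
    and h: "h \<in> borel_measurable (PiM I (\<lambda>_. borel))"
  shows "(\<integral>\<omega>. h (\<lambda>i\<in>I. X i \<omega>) \<partial>M) = integral\<^sup>L (PiM I (\<lambda>_. \<mu>)) h"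
proof -
  have rv: "random_variable borel (X i)" if "i \<in> I" for i
    using X that unfolding indep_vars_def by blast
  have "PiM I (\<lambda>_. \<mu>) = PiM I (\<lambda>i. distr M borel (X i))"
    by (intro PiM_cong) (simp_all add: law)
  also have "\<dots> = distr M (PiM I (\<lambda>_. borel)) (\<lambda>\<omega>. \<lambda>i\<in>I. X i \<omega>)"
    using indep_vars_iff_distr_eq_PiM'[OF assms(1) rv] X by simp
  finally show ?thesis
    by (simp add: integral_distr[OF measurable_restrict[OF rv] h])
qed

text \<open>
  Skorohod's theorem realises \<open>\<mu> n\<close> and \<open>\<nu>\<close> on one probability
  space by variables that converge at every point. On the product of copies of that space all
  coordinates converge at once, and the claim becomes dominated convergence. The integrand may vary
  with \<open>n\<close>, which accommodates normalisations that also depend on \<open>n\<close>.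
\<close>

lemma iid_product_weak_convergence:
  fixes \<mu> :: "nat \<Rightarrow> real measure" and h :: "nat \<Rightarrow> ('i \<Rightarrow> real) \<Rightarrow> real"
  assumes I: "finite I" and \<mu>: "\<And>n. real_distribution (\<mu> n)" and \<nu>: "real_distribution \<nu>"
    and conv: "weak_conv_m \<mu> \<nu>"
    and h: "\<And>n. h n \<in> borel_measurable (PiM I (\<lambda>_. borel))"
    and g: "g \<in> borel_measurable (PiM I (\<lambda>_. borel))"
    and bound: "\<And>n y. \<bar>h n y\<bar> \<le> B"
    and h_to_g: "\<And>y y0. (\<And>i. i \<in> I \<Longrightarrow> (\<lambda>n. y n i) \<longlonglongrightarrow> y0 i) \<Longrightarrow> (\<lambda>n. h n (y n)) \<longlonglongrightarrow> g y0"
  shows "(\<lambda>n. integral\<^sup>L (PiM I (\<lambda>_. \<mu> n)) (h n)) \<longlonglongrightarrow> integral\<^sup>L (PiM I (\<lambda>_. \<nu>)) g"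
proof -
  obtain \<Omega> :: "real measure" and Y :: "nat \<Rightarrow> real \<Rightarrow> real" and Z :: "real \<Rightarrow> real"
    where ps: "prob_space \<Omega>"
      and Y: "\<And>n. Y n \<in> borel_measurable \<Omega>" "\<And>n. distr \<Omega> borel (Y n) = \<mu> n"
      and Z: "Z \<in> borel_measurable \<Omega>" "distr \<Omega> borel Z = \<nu>"
      and lim: "\<And>x. x \<in> space \<Omega> \<Longrightarrow> (\<lambda>n. Y n x) \<longlonglongrightarrow> Z x"
    using Skorohod[OF \<mu> \<nu> conv] by force
  let ?P = "PiM I (\<lambda>_. \<Omega>)"
  interpret P: prob_space ?P by (rule prob_space_PiM) (rule ps)
  have push_meas: "compose I T \<in> ?P \<rightarrow>\<^sub>M PiM I (\<lambda>_. borel)" if "T \<in> borel_measurable \<Omega>" for T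
  proof -
    have "(\<lambda>x. \<lambda>i\<in>I. T (x i)) \<in> ?P \<rightarrow>\<^sub>M PiM I (\<lambda>_. borel)"
      by (intro measurable_restrict measurable_compose[OF _ that] measurable_component_singleton)
    then show ?thesis by (simp add: compose_def[abs_def])
  qed
  have transfer: "integral\<^sup>L (PiM I (\<lambda>_. \<rho>)) f = (\<integral>x. f (compose I T x) \<partial>?P)"
    if T: "T \<in> borel_measurable \<Omega>" "distr \<Omega> borel T = \<rho>" and \<rho>: "real_distribution \<rho>"
      and f: "f \<in> borel_measurable (PiM I (\<lambda>_. borel))" for T \<rho> and f :: "('i \<Rightarrow> real) \<Rightarrow> real"
  proof -
    interpret \<rho>: real_distribution \<rho> by fact
    have s: "sets \<rho> = sets borel" by simp
    have sP: "sets (PiM I (\<lambda>_. \<rho>)) = sets (PiM I (\<lambda>_. borel))"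
      by (intro sets_PiM_cong) simp_all
    have "PiM I (\<lambda>_. \<rho>) = PiM I (\<lambda>_. distr \<Omega> \<rho> T)"
      using T(2) distr_cong[OF refl s, of \<Omega> T T] by simp
    also have "\<dots> = distr ?P (PiM I (\<lambda>_. \<rho>)) (compose I T)"
      using T(1) ps \<rho>.prob_space_axioms
      by (intro distr_PiM_finite_prob_space'[symmetric] I) (auto simp: measurable_cong_sets[OF refl s])
    also have "\<dots> = distr ?P (PiM I (\<lambda>_. borel)) (compose I T)"
      by (intro distr_cong sP) auto
    finally show ?thesis
      by (simp add: integral_distr[OF push_meas[OF T(1)] f])
  qed
  have "(\<lambda>n. \<integral>x. h n (compose I (Y n) x) \<partial>?P) \<longlonglongrightarrow> (\<integral>x. g (compose I Z x) \<partial>?P)"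
  proof (rule integral_dominated_convergence[where w = "\<lambda>_. B"])
    show "AE x in ?P. (\<lambda>n. h n (compose I (Y n) x)) \<longlonglongrightarrow> g (compose I Z x)"
      using lim by (intro AE_I2 h_to_g) (auto simp: compose_def space_PiM)
  qed (use bound in \<open>auto intro!: measurable_compose[OF push_meas] Y Z h g\<close>)
  then show ?thesis
    by (simp add: transfer[OF Y \<mu> h] transfer[OF Z \<nu> g])
qed

text \<open>
  The approximations are the sup-convolutions \<open>F m x = (SUP y. f y - m * dist x y)\<close>.
  For large \<open>m\<close> the penalty excludes points \<open>y\<close> far from \<open>x\<close>,
  because \<open>f\<close> is bounded; near \<open>x\<close> continuity controls \<open>f y\<close>.
\<close>

lemma lipschitz_approximation_from_above:
  fixes f :: "'a::metric_space \<Rightarrow> real"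
  assumes f: "continuous_on UNIV f" and bound: "\<And>x. \<bar>f x\<bar> \<le> B"
  obtains F :: "nat \<Rightarrow> 'a \<Rightarrow> real" where
    "\<And>m x y. \<bar>F m x - F m y\<bar> \<le> real m * dist x y"
    "\<And>m x. f x \<le> F m x" "\<And>m x. \<bar>F m x\<bar> \<le> B" "\<And>x. (\<lambda>m. F m x) \<longlonglongrightarrow> f x"
proof
  define F where "F m x = (SUP y. f y - real m * dist x y)" for m x
  have le_B: "f y - real m * dist x y \<le> B" for x y m
    using bound[of y] by (smt (verit) mult_nonneg_nonneg of_nat_0_le_iff zero_le_dist)
  have bdd: "bdd_above (range (\<lambda>y. f y - real m * dist x y))" for x m
    using le_B by (auto simp: bdd_above_def)
  have le_F: "f y - real m * dist x y \<le> F m x" for m x y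
    unfolding F_def by (rule cSUP_upper[OF _ bdd]) simp
  have F_le: "F m x \<le> c" if "\<And>y. f y - real m * dist x y \<le> c" for m x c
    unfolding F_def by (rule cSUP_least) (use that in auto)
  show above: "f x \<le> F m x" for m x using le_F[of x m x] by simp
  show "\<bar>F m x\<bar> \<le> B" for m x
    using above[of x m] F_le[OF le_B, of m x] bound[of x] by linarith
  have "F m x \<le> F m y + real m * dist x y" for m x y
  proof (rule F_le)
    fix z
    have "real m * dist y z \<le> real m * (dist x y + dist x z)"
      by (intro mult_left_mono dist_triangle3) simp
    then show "f z - real m * dist x z \<le> F m y + real m * dist x y"
      using le_F[of z m y] by (simp add: algebra_simps)
  qed
  from this this[of _ y x for x y] show "\<bar>F m x - F m y\<bar> \<le> real m * dist x y" for m x y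
    by (smt (verit) dist_commute)
  show "(\<lambda>m. F m x) \<longlonglongrightarrow> f x" for x
  proof (rule metric_LIMSEQ_I)
    fix e :: real assume e: "e > 0"
    obtain d where d: "d > 0" and close: "\<And>y. dist y x < d \<Longrightarrow> \<bar>f y - f x\<bar> < e / 2"
      using f half_gt_zero[OF e] unfolding continuous_on_iff dist_real_def by (metis UNIV_I)
    obtain m0 where m0: "real m0 * d > 2 * B" using reals_Archimedean3[OF d] by blast
    have "dist (F m x) (f x) < e" if m: "m \<ge> m0" for m
    proof -
      have "F m x \<le> f x + e / 2"
      proof (rule F_le)
        fix y
        have nn: "0 \<le> real m * dist x y" by simp
        show "f y - real m * dist x y \<le> f x + e / 2"
        proof (cases "dist y x < d")
          case True
          then show ?thesis using close[OF True] nn by linarith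
        next
          case False
          then have "real m0 * d \<le> real m * dist x y"
            using m d by (intro mult_mono) (auto simp: dist_commute)
          then show ?thesis using bound[of x] bound[of y] m0 e by linarith
        qed
      qed
      then show ?thesis using above[of x m] e by (simp add: dist_real_def)
    qed
    then show "\<exists>m0. \<forall>m\<ge>m0. dist (F m x) (f x) < e" by blast
  qed
qed

text \<open>
  Approximation from above by Lipschitz functions bounds the limit superior of the expectations for
  every bounded continuous \<open>f\<close>; applied to \<open>- f\<close> it bounds the limit
  inferior.
\<close>

lemma converges_in_distribution_lipschitzI:
  fixes X :: "nat \<Rightarrow> 'a \<Rightarrow> 's::metric_space" and Y :: "'b \<Rightarrow> 's"
  assumes M: "prob_space M" and N: "prob_space N"
    and X: "\<And>n. X n \<in> borel_measurable M" and Y: "Y \<in> borel_measurable N"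
    and lip: "\<And>(f :: 's \<Rightarrow> real) K B. \<lbrakk>0 \<le> K; \<And>x y. \<bar>f x - f y\<bar> \<le> K * dist x y; \<And>x. \<bar>f x\<bar> \<le> B\<rbrakk>
      \<Longrightarrow> (\<lambda>n. \<integral>\<omega>. f (X n \<omega>) \<partial>M) \<longlonglongrightarrow> (\<integral>\<omega>. f (Y \<omega>) \<partial>N)"
  shows "converges_in_distribution M X N Y"
proof -
  interpret M: prob_space M by fact
  interpret N: prob_space N by fact
  have intM: "integrable M (\<lambda>\<omega>. f (X n \<omega>))" and intN: "integrable N (\<lambda>\<omega>. f (Y \<omega>))"
    if "continuous_on UNIV f" "\<And>x. \<bar>f x\<bar> \<le> B" for f :: "'s \<Rightarrow> real" and B n
    using that by (auto intro!: M.integrable_const_bound[where B = B] N.integrable_const_bound[where B = B]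
      measurable_compose[OF X] measurable_compose[OF Y] borel_measurable_continuous_onI)
  have upper: "eventually (\<lambda>n. (\<integral>\<omega>. f (X n \<omega>) \<partial>M) < (\<integral>\<omega>. f (Y \<omega>) \<partial>N) + e) sequentially"
    if f: "continuous_on UNIV f" and B: "\<And>x. \<bar>f x\<bar> \<le> B" and e: "e > 0"
    for f :: "'s \<Rightarrow> real" and B e
  proof -
    obtain F :: "nat \<Rightarrow> 's \<Rightarrow> real" where F: "\<And>m x y. \<bar>F m x - F m y\<bar> \<le> real m * dist x y"
      "\<And>m x. f x \<le> F m x" "\<And>m x. \<bar>F m x\<bar> \<le> B" "\<And>x. (\<lambda>m. F m x) \<longlonglongrightarrow> f x"
      using lipschitz_approximation_from_above[OF f B] by blast
    have F_cont: "continuous_on UNIV (F m)" for m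
      by (rule lipschitz_imp_continuous[OF _ F(1)]) simp
    have "(\<lambda>m. \<integral>\<omega>. F m (Y \<omega>) \<partial>N) \<longlonglongrightarrow> (\<integral>\<omega>. f (Y \<omega>) \<partial>N)"
      using F(3,4) f F_cont
      by (intro integral_dominated_convergence[where w = "\<lambda>_. B"])
         (auto intro!: measurable_compose[OF Y] borel_measurable_continuous_onI)
    then have "eventually (\<lambda>m. (\<integral>\<omega>. F m (Y \<omega>) \<partial>N) < (\<integral>\<omega>. f (Y \<omega>) \<partial>N) + e) sequentially"
      by (rule order_tendstoD) (use e in simp)
    then obtain m where m: "(\<integral>\<omega>. F m (Y \<omega>) \<partial>N) < (\<integral>\<omega>. f (Y \<omega>) \<partial>N) + e"
      using eventually_happens'[OF sequentially_bot] by blast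
    have "(\<lambda>n. \<integral>\<omega>. F m (X n \<omega>) \<partial>M) \<longlonglongrightarrow> (\<integral>\<omega>. F m (Y \<omega>) \<partial>N)"
      by (rule lip[of "real m"]) (use F in auto)
    from order_tendstoD(2)[OF this m] show ?thesis
    proof (rule eventually_mono)
      fix n assume "(\<integral>\<omega>. F m (X n \<omega>) \<partial>M) < (\<integral>\<omega>. f (Y \<omega>) \<partial>N) + e"
      moreover have "(\<integral>\<omega>. f (X n \<omega>) \<partial>M) \<le> (\<integral>\<omega>. F m (X n \<omega>) \<partial>M)"
        using F by (intro integral_mono intM[OF f B] intM[OF F_cont]) auto
      ultimately show "(\<integral>\<omega>. f (X n \<omega>) \<partial>M) < (\<integral>\<omega>. f (Y \<omega>) \<partial>N) + e" by linarith
    qed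
  qed
  have "(\<lambda>n. \<integral>\<omega>. f (X n \<omega>) \<partial>M) \<longlonglongrightarrow> (\<integral>\<omega>. f (Y \<omega>) \<partial>N)"
    if f: "continuous_on UNIV f" and "bounded (range f)" for f :: "'s \<Rightarrow> real"
  proof (rule tendstoI)
    obtain B where B: "\<And>x. \<bar>f x\<bar> \<le> B" using \<open>bounded (range f)\<close> by (auto simp: bounded_iff)
    fix e :: real assume e: "0 < e"
    have "continuous_on UNIV (\<lambda>x. - f x)" using f by (intro continuous_intros)
    from upper[OF this _ e, of B] upper[OF f B e] B
    have "eventually (\<lambda>n. (\<integral>\<omega>. - f (X n \<omega>) \<partial>M) < (\<integral>\<omega>. - f (Y \<omega>) \<partial>N) + e) sequentially"
      "eventually (\<lambda>n. (\<integral>\<omega>. f (X n \<omega>) \<partial>M) < (\<integral>\<omega>. f (Y \<omega>) \<partial>N) + e) sequentially" by auto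
    then show "eventually (\<lambda>n. dist (\<integral>\<omega>. f (X n \<omega>) \<partial>M) (\<integral>\<omega>. f (Y \<omega>) \<partial>N) < e) sequentially"
      by eventually_elim (auto simp: dist_real_def abs_less_iff)
  qed
  then show ?thesis unfolding converges_in_distribution_def using X Y by blast
qed

section \<open>Fluctuations of a centered random walk\<close>

lemma filterlim_div_const:
  assumes "k \<ge> (1::nat)"
  shows "filterlim (\<lambda>n. n div k) at_top sequentially"
  unfolding filterlim_at_top
proof
  fix Z
  show "eventually (\<lambda>n. Z \<le> n div k) sequentially"
    using assms by (intro eventually_sequentiallyI[of "Z * k"]) (simp add: less_eq_div_iff_mult_less_eq)
qed

lemma (in prob_space) indep_vars_block_sums:
  fixes X :: "'i \<Rightarrow> 'a \<Rightarrow> real"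
  assumes X: "indep_vars (\<lambda>_. borel) X I"
    and K: "\<And>j. j \<in> J \<Longrightarrow> K j \<subseteq> I" "disjoint_family_on K J"
  shows "indep_vars (\<lambda>_. borel) (\<lambda>j \<omega>. \<Sum>i\<in>K j. X i \<omega>) J"
proof -
  have "indep_vars (\<lambda>_. borel) (\<lambda>j \<omega>. \<Sum>i\<in>K j. restrict (\<lambda>i. X i \<omega>) (K j) i) J"
    by (rule indep_vars_compose2[OF indep_vars_restrict[OF X K]])
       (auto intro!: borel_measurable_sum measurable_component_singleton)
  then show ?thesis by simp
qed

text \<open>
  Both sums have as characteristic function the same power of the common one.
\<close>

lemma (in prob_space) distr_iid_sum_eq:
  fixes X :: "'i \<Rightarrow> 'a \<Rightarrow> real"
  assumes X: "indep_vars (\<lambda>_. borel) X I" and law: "\<And>i. i \<in> I \<Longrightarrow> distr M borel (X i) = \<mu>"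
    and AB: "A \<subseteq> I" "B \<subseteq> I" "card A = card B"
  shows "distr M borel (\<lambda>\<omega>. \<Sum>i\<in>A. X i \<omega>) = distr M borel (\<lambda>\<omega>. \<Sum>i\<in>B. X i \<omega>)"
proof (rule Levy_uniqueness)
  have rv: "random_variable borel (X i)" if "i \<in> I" for i
    using X that unfolding indep_vars_def by blast
  show "real_distribution (distr M borel (\<lambda>\<omega>. \<Sum>i\<in>A. X i \<omega>))"
    "real_distribution (distr M borel (\<lambda>\<omega>. \<Sum>i\<in>B. X i \<omega>))"
    using AB by (auto intro!: real_distribution_distr borel_measurable_sum rv)
  have "char (distr M borel (\<lambda>\<omega>. \<Sum>i\<in>C. X i \<omega>)) t = char \<mu> t ^ card C" if "C \<subseteq> I" for C t
    using that law by (subst char_distr_sum[OF indep_vars_subset[OF X that]]) (simp add: subset_iff)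
  then show "char (distr M borel (\<lambda>\<omega>. \<Sum>i\<in>A. X i \<omega>)) = char (distr M borel (\<lambda>\<omega>. \<Sum>i\<in>B. X i \<omega>))"
    using AB by auto
qed

text \<open>
  The mixed terms vanish, because the variables are independent and centered.
\<close>

lemma (in prob_space) second_moment_indep_sum:
  fixes X :: "'i \<Rightarrow> 'a \<Rightarrow> real"
  assumes "finite A" and "indep_vars (\<lambda>_. borel) X A"
    and sq: "\<And>i. i \<in> A \<Longrightarrow> integrable M (\<lambda>\<omega>. (X i \<omega>)\<^sup>2)"
    and mean: "\<And>i. i \<in> A \<Longrightarrow> expectation (X i) = 0"
  shows "integrable M (\<lambda>\<omega>. (\<Sum>i\<in>A. X i \<omega>)\<^sup>2)"
    and "expectation (\<lambda>\<omega>. (\<Sum>i\<in>A. X i \<omega>)\<^sup>2) = (\<Sum>i\<in>A. expectation (\<lambda>\<omega>. (X i \<omega>)\<^sup>2))"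
proof -
  have "integrable M (\<lambda>\<omega>. (\<Sum>i\<in>A. X i \<omega>)\<^sup>2) \<and>
    expectation (\<lambda>\<omega>. (\<Sum>i\<in>A. X i \<omega>)\<^sup>2) = (\<Sum>i\<in>A. expectation (\<lambda>\<omega>. (X i \<omega>)\<^sup>2))"
    using assms
  proof (induction A)
    case empty
    then show ?case by simp
  next
    case (insert a A)
    let ?T = "\<lambda>\<omega>. \<Sum>i\<in>A. X i \<omega>"
    have rv: "random_variable borel (X i)" if "i \<in> insert a A" for i
      using insert.prems(1) that unfolding indep_vars_def by blast
    have T_rv: "random_variable borel ?T" using rv by (intro borel_measurable_sum) auto
    have IH: "integrable M (\<lambda>\<omega>. (?T \<omega>)\<^sup>2)"
      "expectation (\<lambda>\<omega>. (?T \<omega>)\<^sup>2) = (\<Sum>i\<in>A. expectation (\<lambda>\<omega>. (X i \<omega>)\<^sup>2))"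
      using insert.IH indep_vars_subset[OF insert.prems(1)] insert.prems(2,3) by auto
    have X: "integrable M (X a)" "integrable M (\<lambda>\<omega>. (X a \<omega>)\<^sup>2)"
      using square_integrable_imp_integrable[OF rv insert.prems(2)] insert.prems(2) by auto
    have T: "integrable M ?T"
      by (rule square_integrable_imp_integrable[OF T_rv IH(1)])
    have "indep_var borel (X a) borel ?T"
      by (rule indep_vars_sum[OF insert.hyps(1,2) insert.prems(1)])
    note XT = indep_var_integrable[OF this X(1) T] indep_var_lebesgue_integral[OF this X(1) T]
    have eq: "(\<Sum>i\<in>insert a A. X i \<omega>)\<^sup>2 = (X a \<omega>)\<^sup>2 + (2 * (X a \<omega> * ?T \<omega>) + (?T \<omega>)\<^sup>2)" for \<omega>
      using insert.hyps by (simp add: power2_eq_square algebra_simps)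
    have "integrable M (\<lambda>\<omega>. 2 * (X a \<omega> * ?T \<omega>) + (?T \<omega>)\<^sup>2)"
      "integrable M (\<lambda>\<omega>. 2 * (X a \<omega> * ?T \<omega>))"
      using XT(1) IH(1) by auto
    then show ?case
      unfolding eq using X XT IH insert.hyps insert.prems(3) by (simp add: Bochner_Integration.integral_add)
  qed
  then show "integrable M (\<lambda>\<omega>. (\<Sum>i\<in>A. X i \<omega>)\<^sup>2)"
    "expectation (\<lambda>\<omega>. (\<Sum>i\<in>A. X i \<omega>)\<^sup>2) = (\<Sum>i\<in>A. expectation (\<lambda>\<omega>. (X i \<omega>)\<^sup>2))" by auto
qed

text \<open>
  Decompose according to the first time \<open>i\<close> at which the modulus of the walk exceeds
  \<open>2 * a\<close>. That event depends on the steps before \<open>i\<close>, hence is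
  independent of the event that the remaining steps move the walk by at most \<open>a\<close>. The
  latter has probability at least \<open>1 - p\<close>, and if both happen, the modulus of the final
  value still exceeds \<open>a\<close>.
\<close>

lemma (in prob_space) ottaviani_inequality:
  fixes X :: "nat \<Rightarrow> 'a \<Rightarrow> real"
  assumes X: "indep_vars (\<lambda>_. borel) X {..<n}"
    and p: "\<And>i. i \<le> n \<Longrightarrow> prob {\<omega> \<in> space M. \<bar>\<Sum>l\<in>{i..<n}. X l \<omega>\<bar> > a} \<le> p"
  shows "(1 - p) * prob {\<omega> \<in> space M. \<exists>i\<le>n. \<bar>\<Sum>l<i. X l \<omega>\<bar> > 2 * a}
    \<le> prob {\<omega> \<in> space M. \<bar>\<Sum>l<n. X l \<omega>\<bar> > a}"
proof -
  have rv: "random_variable borel (X i)" if "i < n" for i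
    using X that unfolding indep_vars_def by blast
  have S_rv: "random_variable borel (\<lambda>\<omega>. \<Sum>l\<in>A. X l \<omega>)" if "A \<subseteq> {..<n}" for A
    using that rv by (intro borel_measurable_sum) auto
  \<comment> \<open>The sets \<open>first i\<close> partition the event that the modulus of the walk ever exceeds \<open>2 * a\<close>.\<close>
  define first where
    "first i = {\<omega> \<in> space M. \<bar>\<Sum>l<i. X l \<omega>\<bar> > 2 * a \<and> (\<forall>m\<in>{..<i}. \<bar>\<Sum>l<m. X l \<omega>\<bar> \<le> 2 * a)}" for i
  define rest where "rest i = {\<omega> \<in> space M. \<bar>\<Sum>l\<in>{i..<n}. X l \<omega>\<bar> \<le> a}" for i
  have first_ev: "first i \<in> events" if "i \<le> n" for i
    unfolding first_def using that
    by (intro sets.sets_Collect_conj sets.sets_Collect_finite_All borel_measurable_less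
          borel_measurable_le borel_measurable_abs S_rv borel_measurable_const) auto
  have rest_ev: "rest i \<in> events" for i
    unfolding rest_def by (intro borel_measurable_le borel_measurable_abs S_rv borel_measurable_const) auto
  have indep_first_rest: "prob (first i \<inter> rest i) = prob (first i) * prob (rest i)" if i: "i \<le> n" for i
  proof -
    let ?A = "\<lambda>\<omega>. restrict (\<lambda>l. X l \<omega>) {..<i}" and ?B = "\<lambda>\<omega>. restrict (\<lambda>l. X l \<omega>) {i..<n}"
    let ?PA = "PiM {..<i} (\<lambda>_. borel :: real measure)" and ?PB = "PiM {i..<n} (\<lambda>_. borel :: real measure)"
    let ?F = "{y \<in> space ?PA. \<bar>\<Sum>l<i. y l\<bar> > 2 * a \<and> (\<forall>m\<in>{..<i}. \<bar>\<Sum>l<m. y l\<bar> \<le> 2 * a)}"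
    let ?R = "{y \<in> space ?PB. \<bar>\<Sum>l\<in>{i..<n}. y l\<bar> \<le> a}"
    have "indep_var ?PA ?A ?PB ?B"
      by (rule indep_var_restrict[OF X]) (use i in auto)
    moreover have "?F \<in> sets ?PA"
      by (intro sets.sets_Collect_conj sets.sets_Collect_finite_All borel_measurable_less
            borel_measurable_le borel_measurable_abs borel_measurable_sum
            measurable_component_singleton borel_measurable_const) auto
    moreover have "?R \<in> sets ?PB"
      by (intro borel_measurable_le borel_measurable_abs borel_measurable_sum
            measurable_component_singleton borel_measurable_const) auto
    ultimately have "prob ((\<lambda>\<omega>. (?A \<omega>, ?B \<omega>)) -` (?F \<times> ?R) \<inter> space M) =
        prob (?A -` ?F \<inter> space M) * prob (?B -` ?R \<inter> space M)"
      by (rule indep_varD)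
    moreover have A: "?A -` ?F \<inter> space M = first i"
      by (auto simp: first_def space_PiM)
    moreover have B: "?B -` ?R \<inter> space M = rest i"
      by (auto simp: rest_def space_PiM)
    moreover have "(\<lambda>\<omega>. (?A \<omega>, ?B \<omega>)) -` (?F \<times> ?R) \<inter> space M = first i \<inter> rest i"
      unfolding A[symmetric] B[symmetric] by auto
    ultimately show ?thesis by simp
  qed
  have rest_prob: "1 - p \<le> prob (rest i)" if "i \<le> n" for i
  proof -
    have "{\<omega> \<in> space M. \<bar>\<Sum>l\<in>{i..<n}. X l \<omega>\<bar> > a} = space M - rest i"
      by (auto simp: rest_def)
    then show ?thesis using p[OF that] prob_compl[OF rest_ev[of i]] by simp
  qed
  have disj: "disjoint_family_on first {..n}"
  proof -
    have "first i \<inter> first j = {}" if "i < j" for i j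
      using that by (force simp: first_def)
    then show ?thesis
      unfolding disjoint_family_on_def by (metis inf_commute linorder_neqE_nat)
  qed
  have "{\<omega> \<in> space M. \<exists>i\<le>n. \<bar>\<Sum>l<i. X l \<omega>\<bar> > 2 * a} = (\<Union>i\<le>n. first i)"
  proof safe
    fix \<omega> i assume \<omega>: "\<omega> \<in> space M" and i: "i \<le> n" "\<bar>\<Sum>l<i. X l \<omega>\<bar> > 2 * a"
    define m where "m = (LEAST m. \<bar>\<Sum>l<m. X l \<omega>\<bar> > 2 * a)"
    have "\<bar>\<Sum>l<m. X l \<omega>\<bar> > 2 * a" "m \<le> i"
      unfolding m_def using i(2) by (rule LeastI, rule Least_le)
    moreover have "\<bar>\<Sum>l<q. X l \<omega>\<bar> \<le> 2 * a" if "q < m" for q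
      using not_less_Least[OF that[unfolded m_def]] by simp
    ultimately show "\<omega> \<in> (\<Union>i\<le>n. first i)"
      using \<omega> i(1) by (intro UN_I[of m]) (auto simp: first_def)
  qed (auto simp: first_def)
  then have "(1 - p) * prob {\<omega> \<in> space M. \<exists>i\<le>n. \<bar>\<Sum>l<i. X l \<omega>\<bar> > 2 * a} =
      (\<Sum>i\<le>n. (1 - p) * prob (first i))"
    using first_ev disj by (simp add: finite_measure_finite_Union sum_distrib_left image_subset_iff)
  also have "\<dots> \<le> (\<Sum>i\<le>n. prob (first i \<inter> rest i))"
  proof (rule sum_mono)
    fix i assume "i \<in> {..n}"
    then show "(1 - p) * prob (first i) \<le> prob (first i \<inter> rest i)"
      using mult_right_mono[OF rest_prob, of i "prob (first i)"]
      by (simp add: indep_first_rest mult.commute[of "prob (first i)"])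
  qed
  also have "\<dots> = prob (\<Union>i\<le>n. first i \<inter> rest i)"
  proof (rule finite_measure_finite_Union[symmetric])
    show "disjoint_family_on (\<lambda>i. first i \<inter> rest i) {..n}"
      using disj unfolding disjoint_family_on_def by blast
  qed (use first_ev rest_ev in auto)
  also have "\<dots> \<le> prob {\<omega> \<in> space M. \<bar>\<Sum>l<n. X l \<omega>\<bar> > a}"
  proof (rule finite_measure_mono)
    show "{\<omega> \<in> space M. \<bar>\<Sum>l<n. X l \<omega>\<bar> > a} \<in> events"
      by (intro borel_measurable_less borel_measurable_abs S_rv borel_measurable_const) auto
    show "(\<Union>i\<le>n. first i \<inter> rest i) \<subseteq> {\<omega> \<in> space M. \<bar>\<Sum>l<n. X l \<omega>\<bar> > a}"
    proof safe
      fix i \<omega> assume i: "i \<le> n" and \<omega>: "\<omega> \<in> first i" "\<omega> \<in> rest i"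
      have "(\<Sum>l\<in>{..<i} \<union> {i..<n}. X l \<omega>) = (\<Sum>l<i. X l \<omega>) + (\<Sum>l\<in>{i..<n}. X l \<omega>)"
        by (rule sum.union_disjoint) auto
      moreover have "{..<i} \<union> {i..<n} = {..<n}" using i by auto
      ultimately have "(\<Sum>l<n. X l \<omega>) = (\<Sum>l<i. X l \<omega>) + (\<Sum>l\<in>{i..<n}. X l \<omega>)" by simp
      then show "\<bar>\<Sum>l<n. X l \<omega>\<bar> > a" using \<omega> by (auto simp: first_def rest_def)
    qed (auto simp: first_def)
  qed
  finally show ?thesis .
qed

locale centered_iid = prob_space M for M :: "'a measure" +
  fixes X :: "nat \<Rightarrow> 'a \<Rightarrow> real" and \<sigma> :: real
  assumes indep: "indep_vars (\<lambda>_. borel) X UNIV"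
    and ident: "distr M borel (X i) = distr M borel (X 0)"
    and square_integrable: "integrable M (\<lambda>\<omega>. (X i \<omega>)\<^sup>2)"
    and mean_zero: "expectation (X i) = 0"
    and second_moment: "expectation (\<lambda>\<omega>. (X i \<omega>)\<^sup>2) = \<sigma>\<^sup>2"
    and \<sigma>_pos: "\<sigma> > 0"
begin

definition walk :: "nat \<Rightarrow> 'a \<Rightarrow> real" where
  "walk m \<omega> = (\<Sum>i<m. X i \<omega>)"

lemma rv [measurable]: "random_variable borel (X i)"
  using indep unfolding indep_vars_def by blast

lemma walk_rv [measurable]: "random_variable borel (walk m)"
  unfolding walk_def by measurable

lemma walk_increment: "walk (m + i) \<omega> - walk m \<omega> = (\<Sum>l\<in>{m..<m + i}. X l \<omega>)"
proof -
  have "(\<Sum>l\<in>{..<m} \<union> {m..<m + i}. X l \<omega>) = (\<Sum>l<m. X l \<omega>) + (\<Sum>l\<in>{m..<m + i}. X l \<omega>)"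
    by (rule sum.union_disjoint) auto
  moreover have "{..<m} \<union> {m..<m + i} = {..<m + i}" by auto
  ultimately show ?thesis unfolding walk_def by simp
qed

lemma walk_increment_law:
  "distr M borel (\<lambda>\<omega>. walk (m + i) \<omega> - walk m \<omega>) = distr M borel (walk i)"
  unfolding walk_increment unfolding walk_def
  by (rule distr_iid_sum_eq[OF indep ident]) auto

lemma normalized_walk_weak_conv:
  "weak_conv_m (\<lambda>L. distr M borel (\<lambda>\<omega>. walk L \<omega> / (\<sigma> * sqrt (real L)))) std_normal_distribution"
proof -
  have "weak_conv_m (\<lambda>n. distr M borel (\<lambda>\<omega>. (\<Sum>i<n. X i \<omega>) / sqrt (n * \<sigma>\<^sup>2))) std_normal_distribution"
    by (rule central_limit_theorem_zero_mean[OF indep mean_zero \<sigma>_pos square_integrable _ ident])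
       (simp add: mean_zero second_moment)
  then show ?thesis
    using \<sigma>_pos by (simp add: walk_def real_sqrt_mult mult.commute)
qed

lemma walk_chebyshev:
  assumes "finite A" "a > 0"
  shows "prob {\<omega> \<in> space M. \<bar>\<Sum>l\<in>A. X l \<omega>\<bar> > a} \<le> real (card A) * \<sigma>\<^sup>2 / a\<^sup>2"
proof -
  have A: "integrable M (\<lambda>\<omega>. (\<Sum>i\<in>A. X i \<omega>)\<^sup>2)"
    "expectation (\<lambda>\<omega>. (\<Sum>i\<in>A. X i \<omega>)\<^sup>2) = real (card A) * \<sigma>\<^sup>2"
    using second_moment_indep_sum[OF assms(1) indep_vars_subset[OF indep] square_integrable mean_zero]
    by (simp_all add: second_moment)
  have "prob {\<omega> \<in> space M. \<bar>\<Sum>l\<in>A. X l \<omega>\<bar> > a} \<le> prob {\<omega> \<in> space M. \<bar>\<Sum>l\<in>A. X l \<omega>\<bar> \<ge> a}"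
    by (intro finite_measure_mono) auto
  also have "\<dots> \<le> expectation (\<lambda>\<omega>. (\<Sum>i\<in>A. X i \<omega>)\<^sup>2) / a\<^sup>2"
    by (rule second_moment_method) (use A assms(2) in auto)
  finally show ?thesis by (simp add: A(2))
qed

text \<open>
  Ottaviani's inequality with \<open>p = 1/2\<close>: the hypothesis on \<open>c\<close> is what
  Chebyshev's inequality requires for the partial increments of a block.
\<close>

lemma walk_max_fluctuation:
  assumes c: "c\<^sup>2 \<ge> 2" "c > 0" and L: "L > 0"
  shows "prob {\<omega> \<in> space M. \<exists>i\<le>L. \<bar>walk (m + i) \<omega> - walk m \<omega>\<bar> > 2 * (c * \<sigma> * sqrt (real L))}
    \<le> 2 * prob {\<omega> \<in> space M. \<bar>walk L \<omega>\<bar> > c * \<sigma> * sqrt (real L)}"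
proof -
  define a where "a = c * \<sigma> * sqrt (real L)"
  have a: "a > 0" using c L \<sigma>_pos by (simp add: a_def)
  have shift: "(\<Sum>l\<in>{i..<i'}. X (m + l) \<omega>) = (\<Sum>l\<in>{m + i..<m + i'}. X l \<omega>)" for i i' \<omega>
    by (rule sum.reindex_bij_witness[of _ "\<lambda>l. l - m" "\<lambda>l. m + l"]) auto
  have shift0: "(\<Sum>l<i. X (m + l) \<omega>) = walk (m + i) \<omega> - walk m \<omega>" for i \<omega>
  proof -
    have "(\<Sum>l\<in>{0..<i}. X (m + l) \<omega>) = (\<Sum>l\<in>{m + 0..<m + i}. X l \<omega>)" by (rule shift)
    then show ?thesis by (simp add: walk_increment lessThan_atLeast0)
  qed
  have "indep_vars (\<lambda>_. borel) (\<lambda>j \<omega>. \<Sum>i\<in>{m + j}. X i \<omega>) {..<L}"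
    by (rule indep_vars_block_sums[OF indep]) (auto simp: disjoint_family_on_def)
  then have ind: "indep_vars (\<lambda>_. borel) (\<lambda>j. X (m + j)) {..<L}" by simp
  have "(1 - 1 / 2) * prob {\<omega> \<in> space M. \<exists>i\<le>L. \<bar>\<Sum>l<i. X (m + l) \<omega>\<bar> > 2 * a}
      \<le> prob {\<omega> \<in> space M. \<bar>\<Sum>l<L. X (m + l) \<omega>\<bar> > a}"
  proof (rule ottaviani_inequality[OF ind])
    fix i assume i: "i \<le> L"
    have "prob {\<omega> \<in> space M. \<bar>\<Sum>l\<in>{i..<L}. X (m + l) \<omega>\<bar> > a} \<le> real (L - i) * \<sigma>\<^sup>2 / a\<^sup>2"
      unfolding shift using walk_chebyshev[OF _ a, of "{m + i..<m + L}"] by simp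
    also have "\<dots> \<le> real L * \<sigma>\<^sup>2 / a\<^sup>2"
      by (intro divide_right_mono mult_right_mono) auto
    also have "\<dots> = 1 / c\<^sup>2"
      using L \<sigma>_pos c by (simp add: a_def power_mult_distrib field_simps)
    also have "\<dots> \<le> 1 / 2" using c by (intro divide_left_mono) auto
    finally show "prob {\<omega> \<in> space M. \<bar>\<Sum>l\<in>{i..<L}. X (m + l) \<omega>\<bar> > a} \<le> 1 / 2" .
  qed
  also have "\<dots> = prob {\<omega> \<in> space M. \<bar>walk L \<omega>\<bar> > a}"
  proof -
    have *: "prob {\<omega> \<in> space M. \<bar>f \<omega>\<bar> > a} = measure (distr M borel f) {x. \<bar>x\<bar> > a}"
      if [measurable]: "random_variable borel f" for f
      by (subst measure_distr) (auto intro!: arg_cong[where f = prob])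
    show ?thesis unfolding shift0 by (simp add: * walk_increment_law)
  qed
  finally show ?thesis unfolding shift0 a_def by simp
qed

text \<open>
  The indicator of \<open>\<bar>y\<bar> > c\<close> lies below the bounded continuous function
  \<open>min 1 (y^4 / c^4)\<close>, whose expectation converges to a value of at most
  \<open>3 / c^4\<close>, as \<open>3\<close> is the fourth moment of the standard normal law. The
  constant \<open>4\<close> leaves room for the limit.
\<close>

lemma walk_tail_fourth_power:
  assumes c: "c > 0"
  shows "eventually (\<lambda>L. prob {\<omega> \<in> space M. \<bar>walk L \<omega>\<bar> > c * \<sigma> * sqrt (real L)} \<le> 4 / c ^ 4) sequentially"
proof -
  define g where "g y = min 1 (y ^ 4 / c ^ 4)" for y :: real
  have g_cont: "isCont g y" for y unfolding g_def using c by (intro continuous_intros) auto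
  then have [measurable]: "g \<in> borel_measurable borel"
    by (intro borel_measurable_continuous_onI continuous_at_imp_continuous_on) auto
  have g_bound: "0 \<le> g y" "g y \<le> 1" for y unfolding g_def using c by auto
  let ?\<mu> = "\<lambda>L. distr M borel (\<lambda>\<omega>. walk L \<omega> / (\<sigma> * sqrt (real L)))"
  have conv: "(\<lambda>L. integral\<^sup>L (?\<mu> L) g) \<longlonglongrightarrow> integral\<^sup>L std_normal_distribution g"
    by (rule weak_conv_imp_integral_bdd_continuous_conv[OF _ real_dist_normal_dist
          normalized_walk_weak_conv g_cont, of 1]) (use g_bound in auto)
  interpret std: real_distribution std_normal_distribution by (rule real_dist_normal_dist)
  have "integral\<^sup>L std_normal_distribution g \<le> (\<integral>y. y ^ 4 / c ^ 4 \<partial>std_normal_distribution)"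
  proof (rule integral_mono)
    show "integrable std_normal_distribution g"
      by (rule std.integrable_const_bound[where B = 1]) (use g_bound in auto)
    show "integrable std_normal_distribution (\<lambda>y. y ^ 4 / c ^ 4)"
      using integrable_std_normal_distribution_moment[of 4] by simp
  qed (simp add: g_def)
  also have "\<dots> = 3 / c ^ 4"
    using std_normal_distribution_even_moments(1)[of 2] by (simp add: fact_numeral)
  also have "\<dots> < 4 / c ^ 4" using c by (intro divide_strict_right_mono) auto
  finally have "eventually (\<lambda>L. integral\<^sup>L (?\<mu> L) g < 4 / c ^ 4) sequentially"
    by (rule order_tendstoD(2)[OF conv])
  then show ?thesis using eventually_gt_at_top[of 0]
  proof eventually_elim
    fix L :: nat assume less: "integral\<^sup>L (?\<mu> L) g < 4 / c ^ 4" and L: "0 < L"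
    let ?E = "{\<omega> \<in> space M. \<bar>walk L \<omega>\<bar> > c * \<sigma> * sqrt (real L)}"
    have "prob ?E = (\<integral>\<omega>. indicator ?E \<omega> \<partial>M)" by simp
    also have "\<dots> \<le> (\<integral>\<omega>. g (walk L \<omega> / (\<sigma> * sqrt (real L))) \<partial>M)"
    proof (rule integral_mono)
      show "integrable M (indicat_real ?E)"
        by (rule integrable_const_bound[where B = 1]) auto
      show "integrable M (\<lambda>\<omega>. g (walk L \<omega> / (\<sigma> * sqrt (real L))))"
        by (rule integrable_const_bound[where B = 1]) (use g_bound in auto)
      fix \<omega> assume "\<omega> \<in> space M"
      show "indicator ?E \<omega> \<le> g (walk L \<omega> / (\<sigma> * sqrt (real L)))"
      proof (cases "\<omega> \<in> ?E")
        case True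
        then have "c \<le> \<bar>walk L \<omega> / (\<sigma> * sqrt (real L))\<bar>"
          using L \<sigma>_pos by (simp add: field_simps abs_mult)
        then have "c ^ 4 \<le> \<bar>walk L \<omega> / (\<sigma> * sqrt (real L))\<bar> ^ 4"
          using c by (intro power_mono) auto
        then have "c ^ 4 \<le> (walk L \<omega> / (\<sigma> * sqrt (real L))) ^ 4" by (simp only: power_even_abs even_numeral)
        then show ?thesis using c True unfolding g_def by simp
      qed (use g_bound in simp)
    qed
    also have "\<dots> = integral\<^sup>L (?\<mu> L) g" by (subst integral_distr) auto
    finally show "prob ?E \<le> 4 / c ^ 4" using less by simp
  qed
qed

text \<open>
  A block has length \<open>L \<le> n / k\<close>, so a fluctuation larger than
  \<open>d * \<sigma> * sqrt n\<close> is also larger than \<open>2 * c * \<sigma> * sqrt L\<close>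
  with \<open>c = d * sqrt k / 2\<close>. The tail \<open>c^-4\<close> is of order
  \<open>k^-2\<close>, small enough for a union bound over \<open>k + 1\<close> blocks.
\<close>

lemma block_fluctuation:
  assumes k: "k \<ge> 1" and d: "d > 0" and dk: "d\<^sup>2 * real k \<ge> 8"
  shows "eventually (\<lambda>n. prob {\<omega> \<in> space M. \<exists>j\<le>k. \<exists>i\<le>n div k.
      \<bar>walk (j * (n div k) + i) \<omega> - walk (j * (n div k)) \<omega>\<bar> > d * \<sigma> * sqrt (real n)}
    \<le> (real k + 1) * 128 / (d ^ 4 * (real k)\<^sup>2)) sequentially"
proof -
  define c where "c = d * sqrt (real k) / 2"
  have c: "c > 0" "c\<^sup>2 \<ge> 2" using d k dk by (auto simp: c_def power_mult_distrib power_divide)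
  have c4: "c ^ 4 = d ^ 4 * (real k)\<^sup>2 / 16"
  proof -
    have "c ^ 4 = (c\<^sup>2)\<^sup>2" by simp
    also have "\<dots> = (d\<^sup>2 * real k / 4)\<^sup>2" by (simp add: c_def power_mult_distrib power_divide)
    finally show ?thesis by (simp add: power_mult_distrib power_divide)
  qed
  from eventually_conj[OF walk_tail_fourth_power[OF c(1)] eventually_gt_at_top[of 0]]
  have "eventually (\<lambda>n. prob {\<omega> \<in> space M. \<bar>walk (n div k) \<omega>\<bar> > c * \<sigma> * sqrt (real (n div k))} \<le> 4 / c ^ 4
      \<and> 0 < n div k) sequentially"
    by (rule eventually_compose_filterlim[OF _ filterlim_div_const[OF k]])
  then show ?thesis
  proof (rule eventually_mono)
    fix n
    define L where "L = n div k"
    assume "prob {\<omega> \<in> space M. \<bar>walk (n div k) \<omega>\<bar> > c * \<sigma> * sqrt (real (n div k))} \<le> 4 / c ^ 4 \<and> 0 < n div k"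
    then have tail: "prob {\<omega> \<in> space M. \<bar>walk L \<omega>\<bar> > c * \<sigma> * sqrt (real L)} \<le> 4 / c ^ 4" and L: "0 < L"
      by (auto simp: L_def)
    let ?E = "\<lambda>j. {\<omega> \<in> space M. \<exists>i\<le>L. \<bar>walk (j * L + i) \<omega> - walk (j * L) \<omega>\<bar> > 2 * (c * \<sigma> * sqrt (real L))}"
    have "real k * real L \<le> real n"
      unfolding L_def by (metis of_nat_mono of_nat_mult times_div_less_eq_dividend)
    then have "sqrt (real k * real L) \<le> sqrt (real n)" by simp
    then have "d * \<sigma> * sqrt (real k * real L) \<le> d * \<sigma> * sqrt (real n)"
      using d \<sigma>_pos by (intro mult_left_mono) auto
    then have scale: "2 * (c * \<sigma> * sqrt (real L)) \<le> d * \<sigma> * sqrt (real n)"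
      by (simp add: c_def real_sqrt_mult mult_ac)
    have "prob {\<omega> \<in> space M. \<exists>j\<le>k. \<exists>i\<le>L. \<bar>walk (j * L + i) \<omega> - walk (j * L) \<omega>\<bar> > d * \<sigma> * sqrt (real n)}
        \<le> prob (\<Union>j\<le>k. ?E j)"
    proof (rule finite_measure_mono)
      show "(\<Union>j\<le>k. ?E j) \<in> events" by measurable
    qed (use scale in \<open>auto intro: order.strict_trans1\<close>)
    also have "\<dots> \<le> (\<Sum>j\<le>k. prob (?E j))"
      by (intro finite_measure_subadditive_finite) (auto simp: image_subset_iff)
    also have "\<dots> \<le> (\<Sum>j\<le>k. 2 * (4 / c ^ 4))"
    proof (rule sum_mono)
      fix j
      show "prob (?E j) \<le> 2 * (4 / c ^ 4)"
        using walk_max_fluctuation[OF c(2,1) L, of "j * L"] tail by simp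
    qed
    also have "\<dots> = (real k + 1) * 128 / (d ^ 4 * (real k)\<^sup>2)"
      using d k by (simp add: c4 field_simps)
    finally show "prob {\<omega> \<in> space M. \<exists>j\<le>k. \<exists>i\<le>n div k.
      \<bar>walk (j * (n div k) + i) \<omega> - walk (j * (n div k)) \<omega>\<bar> > d * \<sigma> * sqrt (real n)}
      \<le> (real k + 1) * 128 / (d ^ 4 * (real k)\<^sup>2)" unfolding L_def .
  qed
qed

end

section \<open>The rescaled walk and its coarsening\<close>

lemma div_ratio_tendsto:
  assumes k: "k \<ge> 1"
  shows "(\<lambda>n. real (n div k) / real n) \<longlonglongrightarrow> 1 / real k"
proof (rule tendsto_sandwich)
  show "(\<lambda>n. 1 / real k - 1 / real n) \<longlonglongrightarrow> 1 / real k"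
    using tendsto_diff[OF tendsto_const lim_1_over_n, of "1 / real k"] by simp
  show "eventually (\<lambda>n. 1 / real k - 1 / real n \<le> real (n div k) / real n) sequentially"
    using eventually_gt_at_top[of 0]
  proof eventually_elim
    case (elim n)
    have "n < k * (n div k + 1)" using k by (simp add: dividend_less_times_div)
    then have "real n < real k * (real (n div k) + 1)"
      by (metis of_nat_1 of_nat_add of_nat_less_iff of_nat_mult)
    then have "real n * real n \<le> real n * (real k * (real (n div k) + 1))"
      by (intro mult_left_mono) auto
    then show ?case using k elim by (simp add: field_simps)
  qed
  show "eventually (\<lambda>n. real (n div k) / real n \<le> 1 / real k) sequentially"
    using eventually_gt_at_top[of 0]
  proof eventually_elim
    case (elim n)
    have "real (k * (n div k)) \<le> real n" by (intro of_nat_mono) simp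
    then show ?case using k elim by (simp add: field_simps)
  qed
qed simp

context centered_iid
begin

definition path :: "nat \<Rightarrow> 'a \<Rightarrow> C01" where
  "path n \<omega> = polygon n (\<lambda>i. X i \<omega> / (\<sigma> * sqrt (real n)))"

text \<open>
  The increments are normalised by \<open>sqrt n\<close>, like those of the full path, although the
  \<open>k\<close> blocks together cover only \<open>k * (n div k)\<close> steps; the discrepancy
  vanishes in the limit.
\<close>

definition coarse_path :: "nat \<Rightarrow> nat \<Rightarrow> 'a \<Rightarrow> C01" where
  "coarse_path k n \<omega> = polygon k (\<lambda>j. (walk (Suc j * (n div k)) \<omega> - walk (j * (n div k)) \<omega>) / (\<sigma> * sqrt (real n)))"

lemma path_measurable [measurable]: "path n \<in> borel_measurable M"
  unfolding path_def[abs_def] by (intro borel_measurable_polygon) measurable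

lemma coarse_path_measurable [measurable]: "coarse_path k n \<in> borel_measurable M"
  unfolding coarse_path_def[abs_def] by (intro borel_measurable_polygon) measurable

lemma path_linear_interpolation:
  assumes "n \<ge> 1"
  shows "linear_interpolation n (\<lambda>i. walk i \<omega> / (\<sigma> * sqrt (real n))) (path n \<omega>)"
  using polygon_linear_interpolation[OF assms, of "\<lambda>i. walk i \<omega> / (\<sigma> * sqrt (real n))"]
  by (simp add: path_def walk_def diff_divide_distrib[symmetric])

lemma coarse_path_linear_interpolation:
  assumes "k \<ge> 1"
  shows "linear_interpolation k (\<lambda>j. walk (j * (n div k)) \<omega> / (\<sigma> * sqrt (real n))) (coarse_path k n \<omega>)"
  using polygon_linear_interpolation[OF assms, of "\<lambda>j. walk (j * (n div k)) \<omega> / (\<sigma> * sqrt (real n))"]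
  by (simp only: coarse_path_def diff_divide_distrib) (simp add: walk_def)

text \<open>
  The block increments, each normalised by its own standard deviation, are independent with a common
  law that is asymptotically standard normal. Passing to the normalisation of the full path
  multiplies them by \<open>sqrt (n div k / n)\<close>, which tends to \<open>1 / sqrt k\<close>.
\<close>

lemma coarse_path_converges:
  fixes f :: "C01 \<Rightarrow> real"
  assumes k: "k \<ge> 1" and f: "continuous_on UNIV f" and B: "\<And>x. \<bar>f x\<bar> \<le> B"
  shows "(\<lambda>n. \<integral>\<omega>. f (coarse_path k n \<omega>) \<partial>M) \<longlonglongrightarrow>
    (\<integral>y. f (polygon k (\<lambda>j. y j / sqrt (real k))) \<partial>PiM {..<k} (\<lambda>_. std_normal_distribution))"
proof -
  define \<mu> where "\<mu> L = distr M borel (\<lambda>\<omega>. walk L \<omega> / (\<sigma> * sqrt (real L)))" for L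
  define h where "h n y = f (polygon k (\<lambda>j. sqrt (real (n div k) / real n) * y j))" for n and y :: "nat \<Rightarrow> real"
  have f_meas: "f \<in> borel_measurable borel" using f by (rule borel_measurable_continuous_onI)
  have h_meas: "h n \<in> borel_measurable (PiM {..<k} (\<lambda>_. borel))" for n
    unfolding h_def
    by (intro measurable_compose[OF _ f_meas] borel_measurable_polygon borel_measurable_times
          measurable_component_singleton measurable_const) auto
  have g_meas: "(\<lambda>y. f (polygon k (\<lambda>j. y j / sqrt (real k)))) \<in> borel_measurable (PiM {..<k} (\<lambda>_. borel))"
    by (intro measurable_compose[OF _ f_meas] borel_measurable_polygon borel_measurable_divide
          measurable_component_singleton measurable_const) auto
  have finite_dim: "(\<integral>\<omega>. f (coarse_path k n \<omega>) \<partial>M) = integral\<^sup>L (PiM {..<k} (\<lambda>_. \<mu> (n div k))) (h n)" for n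
  proof -
    define L where "L = n div k"
    define T where "T j \<omega> = (walk (Suc j * L) \<omega> - walk (j * L) \<omega>) / (\<sigma> * sqrt (real L))" for j \<omega>
    have incr: "walk (Suc j * L) \<omega> - walk (j * L) \<omega> = (\<Sum>l\<in>{j * L..<Suc j * L}. X l \<omega>)" for j \<omega>
      using walk_increment[of "j * L" L \<omega>] by (simp add: add.commute)
    have "{i * L..<Suc i * L} \<inter> {j * L..<Suc j * L} = {}" if "i < j" for i j
    proof -
      have "Suc i * L \<le> j * L" using that by (intro mult_le_mono1) simp
      then show ?thesis by auto
    qed
    then have "disjoint_family_on (\<lambda>j. {j * L..<Suc j * L}) {..<k}"
      unfolding disjoint_family_on_def by (metis inf_commute linorder_neqE_nat)
    then have "indep_vars (\<lambda>_. borel) (\<lambda>j \<omega>. \<Sum>l\<in>{j * L..<Suc j * L}. X l \<omega>) {..<k}"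
      by (intro indep_vars_block_sums[OF indep]) auto
    then have T_indep: "indep_vars (\<lambda>_. borel) T {..<k}"
      unfolding T_def[abs_def] incr by (rule indep_vars_compose2) simp
    have T_law: "distr M borel (T j) = \<mu> L" for j
    proof -
      have "distr M borel (T j) =
          distr (distr M borel (\<lambda>\<omega>. walk (j * L + L) \<omega> - walk (j * L) \<omega>)) borel (\<lambda>x. x / (\<sigma> * sqrt (real L)))"
        unfolding T_def[abs_def] by (subst distr_distr) (auto simp: comp_def add.commute)
      also have "\<dots> = \<mu> L"
        unfolding walk_increment_law \<mu>_def by (subst distr_distr) (auto simp: comp_def)
      finally show ?thesis .
    qed
    have "f (coarse_path k n \<omega>) = h n (\<lambda>j\<in>{..<k}. T j \<omega>)" for \<omega>
    proof -
      \<comment> \<open>If \<open>L = 0\<close>, both sides vanish, since the block is empty and division by zero gives zero.\<close>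
      have "sqrt (real L / real n) * T j \<omega> = (walk (Suc j * L) \<omega> - walk (j * L) \<omega>) / (\<sigma> * sqrt (real n))" for j
        by (cases "L = 0") (auto simp: T_def real_sqrt_divide)
      then show ?thesis
        unfolding h_def coarse_path_def L_def[symmetric]
        by (intro arg_cong[where f = f] polygon_cong) simp
    qed
    then show ?thesis
      using indep_vars_integral_PiM[OF _ T_indep T_law h_meas, of n] k by (auto simp: L_def lessThan_empty_iff)
  qed
  have "(\<lambda>n. integral\<^sup>L (PiM {..<k} (\<lambda>_. \<mu> (n div k))) (h n)) \<longlonglongrightarrow>
    (\<integral>y. f (polygon k (\<lambda>j. y j / sqrt (real k))) \<partial>PiM {..<k} (\<lambda>_. std_normal_distribution))"
  proof (rule iid_product_weak_convergence[OF _ _ real_dist_normal_dist _ h_meas g_meas])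
    show "real_distribution (\<mu> (n div k))" for n unfolding \<mu>_def by (intro real_distribution_distr) simp
    show "weak_conv_m (\<lambda>n. \<mu> (n div k)) std_normal_distribution"
      unfolding weak_conv_m_def weak_conv_def
    proof (intro allI impI)
      fix x assume "isCont (cdf std_normal_distribution) x"
      then have "(\<lambda>L. cdf (\<mu> L) x) \<longlonglongrightarrow> cdf std_normal_distribution x"
        using normalized_walk_weak_conv by (simp add: weak_conv_m_def weak_conv_def \<mu>_def)
      from filterlim_compose[OF this filterlim_div_const[OF k]]
      show "(\<lambda>n. cdf (\<mu> (n div k)) x) \<longlonglongrightarrow> cdf std_normal_distribution x" .
    qed
    show "\<bar>h n y\<bar> \<le> B" for n y unfolding h_def by (rule B)
    fix y :: "nat \<Rightarrow> nat \<Rightarrow> real" and y0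
    assume y: "\<And>i. i \<in> {..<k} \<Longrightarrow> (\<lambda>n. y n i) \<longlonglongrightarrow> y0 i"
    have "(\<lambda>n. polygon k (\<lambda>j. sqrt (real (n div k) / real n) * y n j)) \<longlonglongrightarrow>
        polygon k (\<lambda>j. sqrt (1 / real k) * y0 j)"
      using y by (intro tendsto_polygon tendsto_mult tendsto_real_sqrt div_ratio_tendsto k) auto
    then show "(\<lambda>n. h n (y n)) \<longlonglongrightarrow> f (polygon k (\<lambda>j. y0 j / sqrt (real k)))"
      unfolding h_def using continuous_on_tendsto_compose[OF f] by (fastforce simp: real_sqrt_divide)
  qed simp
  then show ?thesis unfolding finite_dim .
qed

text \<open>
  Outside the event of a large block fluctuation the two paths are at distance at most
  \<open>3 * d\<close>, and the Lipschitz condition applies; on that event only the bound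
  \<open>2 * B\<close> is available.
\<close>

lemma path_coarse_path_expectation_diff:
  fixes f :: "C01 \<Rightarrow> real"
  assumes k: "k \<ge> 1" and n: "n div k \<ge> k" and d: "d \<ge> 0"
    and K: "0 \<le> K" and lip: "\<And>x y. \<bar>f x - f y\<bar> \<le> K * dist x y" and B: "\<And>x. \<bar>f x\<bar> \<le> B"
  shows "\<bar>(\<integral>\<omega>. f (path n \<omega>) \<partial>M) - (\<integral>\<omega>. f (coarse_path k n \<omega>) \<partial>M)\<bar> \<le>
    3 * K * d + 2 * B * prob {\<omega> \<in> space M. \<exists>j\<le>k. \<exists>i\<le>n div k.
      \<bar>walk (j * (n div k) + i) \<omega> - walk (j * (n div k)) \<omega>\<bar> > d * \<sigma> * sqrt (real n)}"
    (is "_ \<le> _ + _ * prob ?E")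
proof -
  have n1: "n \<ge> 1" using n k by (cases n) auto
  have f_cont: "continuous_on UNIV f" using K lip by (rule lipschitz_imp_continuous)
  then have f_meas[measurable]: "f \<in> borel_measurable borel" by (rule borel_measurable_continuous_onI)
  have int: "integrable M (\<lambda>\<omega>. f (Y \<omega>))" if [measurable]: "Y \<in> borel_measurable M" for Y
    by (rule integrable_const_bound[where B = B]) (use B in auto)
  have E[measurable]: "?E \<in> events" by measurable
  have int_E: "integrable M (indicat_real ?E)"
    by (rule integrable_const_bound[where B = 1]) (use E in auto)
  have B0: "0 \<le> B" using B[of 0] by linarith
  have pointwise: "\<bar>f (path n \<omega>) - f (coarse_path k n \<omega>)\<bar> \<le> 3 * K * d + 2 * B * indicator ?E \<omega>"
    if \<omega>: "\<omega> \<in> space M" for \<omega>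
  proof (cases "\<omega> \<in> ?E")
    case True
    have "0 \<le> 3 * K * d" using K d by simp
    then show ?thesis using True B[of "path n \<omega>"] B[of "coarse_path k n \<omega>"]
      unfolding indicator_simps(1)[OF True] by linarith
  next
    case False
    have "dist (path n \<omega>) (coarse_path k n \<omega>) \<le> 3 * d"
    proof (rule coarse_interpolation_dist[OF k refl n path_linear_interpolation[OF n1]
            coarse_path_linear_interpolation[OF k]])
      fix i j assume "j \<le> k" "i \<le> n div k"
      then have "\<bar>walk (j * (n div k) + i) \<omega> - walk (j * (n div k)) \<omega>\<bar> \<le> d * \<sigma> * sqrt (real n)"
        using False \<omega> by force
      then have "\<bar>(walk (j * (n div k) + i) \<omega> - walk (j * (n div k)) \<omega>) / (\<sigma> * sqrt (real n))\<bar> \<le> d"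
        using \<sigma>_pos n1 by (simp add: abs_mult field_simps)
      then show "\<bar>walk (j * (n div k) + i) \<omega> / (\<sigma> * sqrt (real n)) - walk (j * (n div k)) \<omega> / (\<sigma> * sqrt (real n))\<bar> \<le> d"
        by (simp only: diff_divide_distrib)
    qed
    then have "K * dist (path n \<omega>) (coarse_path k n \<omega>) \<le> K * (3 * d)"
      using K by (rule mult_left_mono)
    then show ?thesis using False lip[of "path n \<omega>" "coarse_path k n \<omega>"] by simp
  qed
  have "\<bar>(\<integral>\<omega>. f (path n \<omega>) \<partial>M) - (\<integral>\<omega>. f (coarse_path k n \<omega>) \<partial>M)\<bar> =
      \<bar>\<integral>\<omega>. f (path n \<omega>) - f (coarse_path k n \<omega>) \<partial>M\<bar>"
    by (simp add: Bochner_Integration.integral_diff int)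
  also have "\<dots> \<le> (\<integral>\<omega>. \<bar>f (path n \<omega>) - f (coarse_path k n \<omega>)\<bar> \<partial>M)"
    by (rule integral_abs_bound)
  also have "\<dots> \<le> (\<integral>\<omega>. 3 * K * d + 2 * B * indicator ?E \<omega> \<partial>M)"
    by (intro integral_mono pointwise) (auto simp: int int_E)
  also have "\<dots> = 3 * K * d + 2 * B * prob ?E"
    using E int_E by (simp add: Bochner_Integration.integral_add prob_space)
  finally show ?thesis .
qed

end

section \<open>The Wiener process along a grid\<close>

text \<open>
  Increments over the cells of the grid are independent and normal with variance \<open>1/k\<close>,
  so after multiplication by \<open>sqrt k\<close> their joint law is a product of standard normal
  laws.
\<close>

lemma wiener_polygon_expectation:
  fixes f :: "C01 \<Rightarrow> real"
  assumes W: "standard_wiener N W" and k: "k \<ge> 1" and f: "continuous_on UNIV f"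
  shows "(\<integral>\<omega>. f (polygon k (\<lambda>j. value_at (W \<omega>) (real (Suc j) / real k) - value_at (W \<omega>) (real j / real k))) \<partial>N) =
    (\<integral>y. f (polygon k (\<lambda>j. y j / sqrt (real k))) \<partial>PiM {..<k} (\<lambda>_. std_normal_distribution))"
proof -
  interpret prob_space N using W by (simp add: standard_wiener_def)
  define D where "D j \<omega> = value_at (W \<omega>) (real (Suc j) / real k) - value_at (W \<omega>) (real j / real k)" for j \<omega>
  have bounds: "0 \<le> real j / real k" "real j / real k < real (Suc j) / real k" "real (Suc j) / real k \<le> 1"
    if "j < k" for j using that by (auto simp: field_simps)
  have "{real i / real k<..real (Suc i) / real k} \<inter> {real j / real k<..real (Suc j) / real k} = {}"
    if "i < j" for i j
  proof -
    have "real (Suc i) / real k \<le> real j / real k" using that by (intro divide_right_mono) auto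
    then show ?thesis by auto
  qed
  then have "disjoint_family_on (\<lambda>j. {real j / real k<..real (Suc j) / real k}) {..<k}"
    unfolding disjoint_family_on_def by (metis inf_commute linorder_neqE_nat)
  then have "indep_vars (\<lambda>_. borel) D {..<k}"
    using W bounds unfolding standard_wiener_def D_def[abs_def] by (simp add: less_imp_le)
  then have ind: "indep_vars (\<lambda>_. borel) (\<lambda>j \<omega>. sqrt (real k) * D j \<omega>) {..<k}"
    by (rule indep_vars_compose2) simp
  have law: "distr N borel (\<lambda>\<omega>. sqrt (real k) * D j \<omega>) = std_normal_distribution" if j: "j \<in> {..<k}" for j
  proof -
    have "real (Suc j) / real k - real j / real k = 1 / real k"
      by (simp add: diff_divide_distrib[symmetric])
    moreover have "distributed N lborel (\<lambda>\<omega>. value_at (W \<omega>) t - value_at (W \<omega>) s) (normal_density 0 (sqrt (t - s)))"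
      if "0 \<le> s" "s < t" "t \<le> 1" for s t
      using W that by (simp add: standard_wiener_def)
    from this[OF bounds] j
    have "distributed N lborel (D j) (normal_density 0 (sqrt (real (Suc j) / real k - real j / real k)))"
      unfolding D_def[abs_def] by simp
    ultimately have "distributed N lborel (D j) (normal_density 0 (sqrt (1 / real k)))" by (simp only:)
    then have "distributed N lborel (\<lambda>\<omega>. (D j \<omega> - 0) / sqrt (1 / real k)) std_normal_density"
      using k by (subst (asm) normal_standard_normal_convert) auto
    then have "distributed N lborel (\<lambda>\<omega>. sqrt (real k) * D j \<omega>) std_normal_density"
      by (simp add: real_sqrt_divide mult.commute)
    then have "distr N lborel (\<lambda>\<omega>. sqrt (real k) * D j \<omega>) = std_normal_distribution"
      by (rule distributed_distr_eq_density)
    moreover have "distr N borel (\<lambda>\<omega>. sqrt (real k) * D j \<omega>) = distr N lborel (\<lambda>\<omega>. sqrt (real k) * D j \<omega>)"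
      by (rule distr_cong) simp_all
    ultimately show ?thesis by simp
  qed
  have meas: "(\<lambda>y. f (polygon k (\<lambda>j. y j / sqrt (real k)))) \<in> borel_measurable (PiM {..<k} (\<lambda>_. borel))"
    by (intro measurable_compose[OF _ borel_measurable_continuous_onI[OF f]] borel_measurable_polygon
          borel_measurable_divide measurable_component_singleton measurable_const) auto
  have "(\<integral>\<omega>. f (polygon k (\<lambda>j. (\<lambda>j\<in>{..<k}. sqrt (real k) * D j \<omega>) j / sqrt (real k))) \<partial>N) =
    (\<integral>y. f (polygon k (\<lambda>j. y j / sqrt (real k))) \<partial>PiM {..<k} (\<lambda>_. std_normal_distribution))"
    by (rule indep_vars_integral_PiM[OF _ ind law meas]) (use k in \<open>auto simp: lessThan_empty_iff\<close>)
  also have "(\<lambda>\<omega>. f (polygon k (\<lambda>j. (\<lambda>j\<in>{..<k}. sqrt (real k) * D j \<omega>) j / sqrt (real k)))) =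
      (\<lambda>\<omega>. f (polygon k (\<lambda>j. D j \<omega>)))"
    using k by (intro ext arg_cong[where f = f] polygon_cong) simp
  finally show ?thesis unfolding D_def .
qed

text \<open>
  The integrals are expectations of \<open>f\<close> at the interpolated Wiener path, which
  converges uniformly to the Wiener path at every sample point where the latter starts at
  \<open>0\<close>.
\<close>

lemma wiener_polygon_converges:
  fixes f :: "C01 \<Rightarrow> real"
  assumes W: "standard_wiener N W" and f: "continuous_on UNIV f" and B: "\<And>x. \<bar>f x\<bar> \<le> B"
  shows "(\<lambda>k. \<integral>y. f (polygon k (\<lambda>j. y j / sqrt (real k))) \<partial>PiM {..<k} (\<lambda>_. std_normal_distribution))
    \<longlonglongrightarrow> (\<integral>\<omega>. f (W \<omega>) \<partial>N)"
proof -
  interpret prob_space N using W by (simp add: standard_wiener_def)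
  have W_meas: "W \<in> borel_measurable N" and W0: "AE \<omega> in N. value_at (W \<omega>) 0 = 0"
    using W by (simp_all add: standard_wiener_def)
  have f_meas: "f \<in> borel_measurable borel" using f by (rule borel_measurable_continuous_onI)
  have at_meas: "(\<lambda>\<omega>. value_at (W \<omega>) t) \<in> borel_measurable N" for t
  proof -
    have "continuous_on UNIV (\<lambda>x :: C01. value_at x t)"
    proof (rule lipschitz_imp_continuous[of 1])
      fix x y :: C01
      show "\<bar>value_at x t - value_at y t\<bar> \<le> 1 * dist x y"
        using dist_bounded[of x _ y] by (simp add: value_at_def dist_real_def)
    qed simp
    from measurable_compose[OF W_meas borel_measurable_continuous_onI[OF this]] show ?thesis .
  qed
  let ?p = "\<lambda>k \<omega>. polygon k (\<lambda>j. value_at (W \<omega>) (real (Suc j) / real k) - value_at (W \<omega>) (real j / real k))"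
  have "(\<lambda>k. \<integral>\<omega>. f (?p (Suc k) \<omega>) \<partial>N) \<longlonglongrightarrow> (\<integral>\<omega>. f (W \<omega>) \<partial>N)"
  proof (rule integral_dominated_convergence[where w = "\<lambda>_. B"])
    show "AE \<omega> in N. (\<lambda>k. f (?p (Suc k) \<omega>)) \<longlonglongrightarrow> f (W \<omega>)"
      using W0
    proof eventually_elim
      case (elim \<omega>)
      have "(\<lambda>k. ?p (Suc k) \<omega>) \<longlonglongrightarrow> W \<omega>"
        by (rule interpolations_converge, rule polygon_linear_interpolation) (use elim in simp_all)
      then show ?case using continuous_on_tendsto_compose[OF f] by fastforce
    qed
    show "(\<lambda>\<omega>. f (?p (Suc k) \<omega>)) \<in> borel_measurable N" for k
      by (intro measurable_compose[OF _ f_meas] borel_measurable_polygon borel_measurable_diff at_meas)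
  qed (use B in \<open>auto intro: measurable_compose[OF W_meas f_meas]\<close>)
  moreover have "(\<integral>\<omega>. f (?p (Suc k) \<omega>) \<partial>N) = (\<integral>y. f (polygon (Suc k) (\<lambda>j. y j / sqrt (real (Suc k))))
      \<partial>PiM {..<Suc k} (\<lambda>_. std_normal_distribution))" for k
    by (rule wiener_polygon_expectation[OF W _ f]) simp
  ultimately have "(\<lambda>k. \<integral>y. f (polygon (Suc k) (\<lambda>j. y j / sqrt (real (Suc k))))
      \<partial>PiM {..<Suc k} (\<lambda>_. std_normal_distribution)) \<longlonglongrightarrow> (\<integral>\<omega>. f (W \<omega>) \<partial>N)"
    by (simp only:)
  then show ?thesis by (rule LIMSEQ_imp_Suc)
qed

section \<open>Donsker's theorem\<close>

text \<open>
  The order of choices matters: \<open>d\<close> makes the Lipschitz error small, then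
  \<open>k\<close> controls the fluctuation bound and the interpolation of the Wiener path, and
  \<open>n\<close> comes last, for this fixed \<open>k\<close>.
\<close>

lemma (in centered_iid) path_lipschitz_expectation_converges:
  fixes f :: "C01 \<Rightarrow> real"
  assumes W: "standard_wiener N W"
    and K: "0 \<le> K" and lip: "\<And>x y. \<bar>f x - f y\<bar> \<le> K * dist x y" and B: "\<And>x. \<bar>f x\<bar> \<le> B"
  shows "(\<lambda>n. \<integral>\<omega>. f (path n \<omega>) \<partial>M) \<longlonglongrightarrow> (\<integral>\<omega>. f (W \<omega>) \<partial>N)"
proof (rule tendstoI)
  fix e :: real assume e: "e > 0"
  have f: "continuous_on UNIV f" using K lip by (rule lipschitz_imp_continuous)
  let ?g = "\<lambda>k. \<integral>y. f (polygon k (\<lambda>j. y j / sqrt (real k))) \<partial>PiM {..<k} (\<lambda>_. std_normal_distribution)"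
  define d where "d = e / (12 * (K + 1))"
  have d: "d > 0" using e K by (simp add: d_def)
  have Kd: "3 * K * d < e / 4"
    using e K by (simp add: d_def field_simps)
  have B0: "0 \<le> B" using B[of 0] by linarith
  have "eventually (\<lambda>k. dist (?g k) (\<integral>\<omega>. f (W \<omega>) \<partial>N) < e / 4) sequentially"
    by (rule tendstoD[OF wiener_polygon_converges[OF W f B]]) (use e in simp)
  moreover have "eventually (\<lambda>k. 2 * B * ((real k + 1) * 128 / (d ^ 4 * (real k)\<^sup>2)) < e / 4) sequentially"
  proof -
    have "(\<lambda>k. 2 * B * ((1 / real k + 1 / real k * (1 / real k)) * (128 / d ^ 4))) \<longlonglongrightarrow> 2 * B * ((0 + 0 * 0) * (128 / d ^ 4))"
      by (intro tendsto_intros lim_1_over_n)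
    then have "eventually (\<lambda>k. 2 * B * ((1 / real k + 1 / real k * (1 / real k)) * (128 / d ^ 4)) < e / 4) sequentially"
      by (rule order_tendstoD(2)) (use e in simp)
    then show ?thesis using eventually_gt_at_top[of 0]
    proof eventually_elim
      case (elim k)
      have "(1 / real k + 1 / real k * (1 / real k)) * (128 / d ^ 4) = (real k + 1) * 128 / (d ^ 4 * (real k)\<^sup>2)"
        using elim(2) d by (simp add: field_simps power2_eq_square)
      then show ?case using elim(1) by simp
    qed
  qed
  moreover have "eventually (\<lambda>k. d\<^sup>2 * real k \<ge> 8) sequentially"
  proof -
    obtain k0 where k0: "real k0 * d\<^sup>2 > 8" using reals_Archimedean3[of "d\<^sup>2"] d by auto
    show ?thesis
    proof (rule eventually_sequentiallyI)
      fix k assume "k0 \<le> k"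
      then have "real k0 * d\<^sup>2 \<le> real k * d\<^sup>2" by (intro mult_right_mono) auto
      then show "d\<^sup>2 * real k \<ge> 8" using k0 by (simp add: mult.commute)
    qed
  qed
  moreover have "eventually (\<lambda>k. k \<ge> (1::nat)) sequentially" by (rule eventually_ge_at_top)
  ultimately have "eventually (\<lambda>k. dist (?g k) (\<integral>\<omega>. f (W \<omega>) \<partial>N) < e / 4 \<and>
      2 * B * ((real k + 1) * 128 / (d ^ 4 * (real k)\<^sup>2)) < e / 4 \<and> d\<^sup>2 * real k \<ge> 8 \<and> k \<ge> 1) sequentially"
    by (intro eventually_conj)
  then obtain k where wk: "dist (?g k) (\<integral>\<omega>. f (W \<omega>) \<partial>N) < e / 4"
    and Bk: "2 * B * ((real k + 1) * 128 / (d ^ 4 * (real k)\<^sup>2)) < e / 4"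
    and dk: "d\<^sup>2 * real k \<ge> 8" and k: "k \<ge> 1"
    using eventually_happens'[OF sequentially_bot] by blast
  have "eventually (\<lambda>n. dist (\<integral>\<omega>. f (coarse_path k n \<omega>) \<partial>M) (?g k) < e / 4) sequentially"
    by (rule tendstoD[OF coarse_path_converges[OF k f B]]) (use e in simp)
  moreover have "eventually (\<lambda>n. n div k \<ge> k) sequentially"
    using filterlim_div_const[OF k] unfolding filterlim_at_top by blast
  ultimately show "eventually (\<lambda>n. dist (\<integral>\<omega>. f (path n \<omega>) \<partial>M) (\<integral>\<omega>. f (W \<omega>) \<partial>N) < e) sequentially"
    using block_fluctuation[OF k d dk]
  proof eventually_elim
    case (elim n)
    have "2 * B * prob {\<omega> \<in> space M. \<exists>j\<le>k. \<exists>i\<le>n div k.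
        \<bar>walk (j * (n div k) + i) \<omega> - walk (j * (n div k)) \<omega>\<bar> > d * \<sigma> * sqrt (real n)} < e / 4"
      using mult_left_mono[OF elim(3), of "2 * B"] B0 Bk by simp
    moreover note path_coarse_path_expectation_diff[OF k elim(2) less_imp_le[OF d] K lip B]
    ultimately have "\<bar>(\<integral>\<omega>. f (path n \<omega>) \<partial>M) - (\<integral>\<omega>. f (coarse_path k n \<omega>) \<partial>M)\<bar> < e / 2"
      using Kd by linarith
    then show ?case using elim(1) wk unfolding dist_real_def by linarith
  qed
qed

theorem theorem4p19:
  fixes M :: "'a measure" and N :: "'b measure"
    and \<xi> :: "nat \<Rightarrow> 'a \<Rightarrow> real" and \<sigma> :: real
    and S :: "nat \<Rightarrow> 'a \<Rightarrow> real"
    and X :: "nat \<Rightarrow> 'a \<Rightarrow> C01" and W :: "'b \<Rightarrow> C01"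
  assumes prob: "prob_space M"
    and indep: "prob_space.indep_vars M (\<lambda>_. borel) \<xi> {1..}"
    and ident: "\<And>i. i \<ge> 1 \<Longrightarrow> distr M borel (\<xi> i) = distr M borel (\<xi> 1)"
    and finite_variance: "\<And>i. i \<ge> 1 \<Longrightarrow> integrable M (\<lambda>\<omega>. (\<xi> i \<omega>)\<^sup>2)"
    and zero_mean: "\<And>i. i \<ge> 1 \<Longrightarrow> prob_space.expectation M (\<xi> i) = 0"
    and variance: "\<And>i. i \<ge> 1 \<Longrightarrow> prob_space.variance M (\<xi> i) = \<sigma>\<^sup>2"
    and sigma_pos: "\<sigma> > 0"
    and S: "\<And>n \<omega>. S n \<omega> = (\<Sum>i\<in>{1..n}. \<xi> i \<omega>)"
    and X: "\<And>n \<omega>. n \<ge> 1 \<Longrightarrow> \<omega> \<in> space M \<Longrightarrow>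
              linear_interpolation n (\<lambda>i. S i \<omega> / (\<sigma> * sqrt (real n))) (X n \<omega>)"
    and W: "standard_wiener N W"
  shows "converges_in_distribution M (\<lambda>n. X (Suc n)) N W"
proof -
  interpret M: prob_space M by fact
  \<comment> \<open>The sequence is shifted to start at index \<open>0\<close>, by viewing its members as sums over singleton blocks.\<close>
  have "M.indep_vars (\<lambda>_. borel) (\<lambda>j \<omega>. \<Sum>i\<in>{Suc j}. \<xi> i \<omega>) UNIV"
    by (rule M.indep_vars_block_sums[OF indep]) (auto simp: disjoint_family_on_def)
  then have shifted: "M.indep_vars (\<lambda>_. borel) (\<lambda>j. \<xi> (Suc j)) UNIV" by simp
  interpret centered_iid M "\<lambda>i. \<xi> (Suc i)" \<sigma>
  proof
    show "distr M borel (\<xi> (Suc i)) = distr M borel (\<xi> (Suc 0))" for i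
      using ident[of "Suc i"] by simp
    show "M.expectation (\<lambda>\<omega>. (\<xi> (Suc i) \<omega>)\<^sup>2) = \<sigma>\<^sup>2" for i
      using variance[of "Suc i"] zero_mean[of "Suc i"] by simp
  qed (use shifted finite_variance zero_mean sigma_pos in auto)
  have S_walk: "S i \<omega> = walk i \<omega>" for i \<omega>
    unfolding S walk_def by (rule sum.reindex_bij_witness[of _ Suc "\<lambda>i. i - 1"]) auto
  have X_path: "X (Suc n) \<omega> = path (Suc n) \<omega>" if "\<omega> \<in> space M" for n \<omega>
    using X[of "Suc n" \<omega>] that path_linear_interpolation[of "Suc n" \<omega>]
    unfolding S_walk by (intro linear_interpolation_unique[of "Suc n"]) auto
  show ?thesis
  proof (rule converges_in_distribution_lipschitzI)
    show "prob_space N" "W \<in> borel_measurable N" using W by (simp_all add: standard_wiener_def)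
    show "X (Suc n) \<in> borel_measurable M" for n
      using path_measurable[of "Suc n"] by (subst measurable_cong[OF X_path])
    fix f :: "C01 \<Rightarrow> real" and K B
    assume f: "0 \<le> K" "\<And>x y. \<bar>f x - f y\<bar> \<le> K * dist x y" "\<And>x. \<bar>f x\<bar> \<le> B"
    have "(\<integral>\<omega>. f (X (Suc n) \<omega>) \<partial>M) = (\<integral>\<omega>. f (path (Suc n) \<omega>) \<partial>M)" for n
      by (intro Bochner_Integration.integral_cong refl) (simp add: X_path)
    then show "(\<lambda>n. \<integral>\<omega>. f (X (Suc n) \<omega>) \<partial>M) \<longlonglongrightarrow> (\<integral>\<omega>. f (W \<omega>) \<partial>N)"
      using LIMSEQ_Suc[OF path_lipschitz_expectation_converges[OF W f]] by simp
  qed fact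
qed

end
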